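(* Let $H$, $A$, $\rho\in(0,1)$, $T>0$ be as in the context, and consider the homogeneous backward problem $$\partial_t^\rho u(t)+Au(t)=0,\quad 0<t<T;\qquad u(T)=\Phi .$$ For any $\Phi\in D(A^2)$ this problem has a unique solution $u$. Moreover, there exist constants $C_1,C_2>0$, not depending on $\Phi$, such that for every $\Phi\in D(A^2)$ the corresponding solution satisfies $$C_1\lim_{t\to 0}\|\partial_t^{\rho-1}u(t)\|\le \|u(T)\|_2\le C_2\lim_{t\to 0}\|\partial_t^{\rho-1}u(t)\| .$$
   Context: $H$ is a separable Hilbert space with scalar product $(\cdot,\cdot)$ and norm $\|\cdot\|$. $A$ is an unbounded positive selfadjoint operator in $H$ having a system of orthonormal eigenvectors $\{v_k\}_{k\ge1}$ that is complete in $H$, with eigenvalues $0<\lambda_1\le\lambda_2\le\cdots\to+\infty$ ($Av_k=\lambda_kv_k$). For real $\tau$, $A^\tau g=\sum_{k\ge1}\lambda_k^\tau (g,v_k)v_k$ with domain $D(A^\tau)=\{g\in H:\sum_k\lambda_k^{2\tau}|(g,v_k)|^2<\infty\}$, and $\|g\|_\tau=\|A^\tau g\|=\big(\sum_k\lambda_k^{2\tau}|(g,v_k)|^2\big)^{1/2}$. For $H$-valued functions $h$ (integrals and derivatives in the strong sense), the fractional integral of order $\sigma<0$ is $\partial_t^\sigma h(t)=\frac{1}{\Gamma(-\sigma)}\int_0^t\frac{h(\xi)}{(t-\xi)^{\sigma+1}}\,d\xi$, $t>0$, provided the right-hand side exists. For $0<\rho<1$ the Riemann–Liouville derivative is $\partial_t^\rho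 h(t)=\frac{d}{dt}\partial_t^{\rho-1}h(t)$. A solution of the backward problem $\partial_t^\rho u(t)+Au(t)=f(t)$ ($0<t<T$), $u(T)=\Phi$, is a function $u\in C((0,T];H)$ such that $\partial_t^\rho u(t)\in C((0,T);H)$ and $Au(t)\in C((0,T);H)$ and both conditions hold. *)

theory Defs
  imports "HOL-Analysis.Analysis"
begin

(* Hilbert spaces are rendered by the sort {real_inner, banach, second_countable_topology}.
   A complex Hilbert space is covered by passing to the real scalar product Re (x, y) and
   the basis v_1, i v_1, v_2, i v_2, ... with each eigenvalue doubled: domains, norms,
   selfadjointness, integrals and derivatives are the same.

   An unbounded operator is a total function A together with its domain D; the values
   of A outside D are irrelevant. *)

definition adjoint_graph :: "'a::real_inner set \<Rightarrow> ('a \<Rightarrow> 'a) \<Rightarrow> ('a \<times> 'a) set" where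
  "adjoint_graph D A = {(y, z). \<forall>x\<in>D. inner (A x) y = inner x z}"

definition selfadjoint_operator :: "'a::real_inner set \<Rightarrow> ('a \<Rightarrow> 'a) \<Rightarrow> bool" where
  "selfadjoint_operator D A \<longleftrightarrow>
     subspace D \<and> closure D = UNIV \<and>
     (\<forall>x\<in>D. \<forall>y\<in>D. A (x + y) = A x + A y) \<and>
     (\<forall>c. \<forall>x\<in>D. A (c *\<^sub>R x) = c *\<^sub>R A x) \<and>
     adjoint_graph D A = {(y, A y) |y. y \<in> D}"

(* The eigenvectors and eigenvalues are indexed from 0 instead of 1. *)
locale eigen_operator =
  fixes D :: "'a::{real_inner, banach, second_countable_topology} set"
    and A :: "'a \<Rightarrow> 'a"
    and v :: "nat \<Rightarrow> 'a"
    and lam :: "nat \<Rightarrow> real"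
  assumes selfadjoint: "selfadjoint_operator D A"
    and positive: "\<And>x. x \<in> D \<Longrightarrow> x \<noteq> 0 \<Longrightarrow> inner (A x) x > 0"
    and unbounded: "\<not> (\<exists>c. \<forall>x\<in>D. norm (A x) \<le> c * norm x)"
    and orthonormal: "\<And>i j. inner (v i) (v j) = (if i = j then 1 else 0)"
    and complete_system: "closure (span (range v)) = UNIV"
    and eigenvector_dom: "\<And>k. v k \<in> D"
    and eigenvector: "\<And>k. A (v k) = lam k *\<^sub>R v k"
    and eigenvalue_pos: "0 < lam 0"
    and eigenvalue_incseq: "incseq lam"
    and eigenvalue_at_top: "filterlim lam at_top sequentially"

definition pow_dom :: "(nat \<Rightarrow> 'a::real_inner) \<Rightarrow> (nat \<Rightarrow> real) \<Rightarrow> real \<Rightarrow> 'a set" where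
  "pow_dom v lam \<tau> = {g. summable (\<lambda>k. lam k powr (2 * \<tau>) * \<bar>inner g (v k)\<bar>\<^sup>2)}"

definition op_pow :: "(nat \<Rightarrow> 'a::real_inner) \<Rightarrow> (nat \<Rightarrow> real) \<Rightarrow> real \<Rightarrow> 'a \<Rightarrow> 'a" where
  "op_pow v lam \<tau> g = (\<Sum>k. (lam k powr \<tau> * inner g (v k)) *\<^sub>R v k)"

definition pow_norm :: "(nat \<Rightarrow> 'a::real_inner) \<Rightarrow> (nat \<Rightarrow> real) \<Rightarrow> real \<Rightarrow> 'a \<Rightarrow> real" where
  "pow_norm v lam \<tau> g = norm (op_pow v lam \<tau> g)"

(* Strong integrals are Bochner integrals. The fractional integral is meant for orders
   \<sigma> < 0; it is a total function, so its existence is recorded separately. *)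
definition frac_integrable ::
  "real \<Rightarrow> (real \<Rightarrow> 'a::{banach, second_countable_topology}) \<Rightarrow> real \<Rightarrow> bool" where
  "frac_integrable \<sigma> h t \<longleftrightarrow>
     set_integrable lborel {0<..<t} (\<lambda>\<xi>. (1 / (t - \<xi>) powr (\<sigma> + 1)) *\<^sub>R h \<xi>)"

definition frac_integral ::
  "real \<Rightarrow> (real \<Rightarrow> 'a::{banach, second_countable_topology}) \<Rightarrow> real \<Rightarrow> 'a" where
  "frac_integral \<sigma> h t =
     (1 / Gamma (- \<sigma>)) *\<^sub>R
       set_lebesgue_integral lborel {0<..<t} (\<lambda>\<xi>. (1 / (t - \<xi>) powr (\<sigma> + 1)) *\<^sub>R h \<xi>)"

definition RL_deriv ::
  "real \<Rightarrow> (real \<Rightarrow> 'a::{banach, second_countable_topology}) \<Rightarrow> real \<Rightarrow> 'a" where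
  "RL_deriv \<rho> h t = vector_derivative (frac_integral (\<rho> - 1) h) (at t)"

definition RL_differentiable_on ::
  "real \<Rightarrow> (real \<Rightarrow> 'a::{banach, second_countable_topology}) \<Rightarrow> real set \<Rightarrow> bool" where
  "RL_differentiable_on \<rho> h S \<longleftrightarrow>
     (\<forall>t\<in>S. frac_integrable (\<rho> - 1) h t \<and> frac_integral (\<rho> - 1) h differentiable (at t))"

definition backward_solution ::
  "'a::{real_inner, banach, second_countable_topology} set \<Rightarrow> ('a \<Rightarrow> 'a) \<Rightarrow> real \<Rightarrow> real
    \<Rightarrow> (real \<Rightarrow> 'a) \<Rightarrow> 'a \<Rightarrow> (real \<Rightarrow> 'a) \<Rightarrow> bool" where
  "backward_solution D A \<rho> T f \<Phi> u \<longleftrightarrow>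
     continuous_on {0<..T} u \<and>
     RL_differentiable_on \<rho> u {0<..<T} \<and>
     continuous_on {0<..<T} (RL_deriv \<rho> u) \<and>
     (\<forall>t\<in>{0<..<T}. u t \<in> D) \<and>
     continuous_on {0<..<T} (\<lambda>t. A (u t)) \<and>
     (\<forall>t\<in>{0<..<T}. RL_deriv \<rho> u t + A (u t) = f t) \<and>
     u T = \<Phi>"

end

theory Submission
  imports Defs "HOL-Real_Asymp.Real_Asymp"
begin

text \<open>In the eigenbasis every solution is \<open>u\<^sub>k(t) = c\<^sub>k t\<^bsup>\<rho>-1\<^esup> E\<^bsub>\<rho>,\<rho>\<^esub>(- \<lambda>\<^sub>k t\<^bsup>\<rho>\<^esup>)\<close> with
  \<open>c\<^sub>k\<close> the limit at \<open>0\<close> of the fractional integral of \<open>u\<^sub>k\<close>, so everything rests on the two-sided bound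
  \<open>q \<le> x\<^sup>2 E\<^bsub>\<rho>,\<rho>\<^esub>(-x) \<le> Q\<close> for \<open>x\<close> away from \<open>0\<close>. This is obtained without contour integrals.
  The function \<open>e(t) = t\<^bsup>\<rho>-1\<^esup> E\<^bsub>\<rho>,\<rho>\<^esub>(-t\<^bsup>\<rho>\<^esup>)\<close> solves the Volterra equation \<open>e + k * e = k\<close> with the
  log-convex kernel \<open>k(t) = t\<^bsup>\<rho>-1\<^esup> / \<Gamma>(\<rho>)\<close>, and a comparison argument gives \<open>E\<^bsub>\<rho>,\<rho>\<^esub>(-x) > 0\<close>; the same
  argument for the equation satisfied by the derivative shows that \<open>E\<^bsub>\<rho>,\<rho>\<^esub>(-x)\<close> decreases. The equations
  relating \<open>z(x) = E\<^bsub>\<rho>,1\<^esub>(-x)\<close> and \<open>e\<close> then pin \<open>x z(x)\<close> between positive constants for large \<open>x\<close>, and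
  since \<open>z' = - E\<^bsub>\<rho>,\<rho>\<^esub>(-x) / \<rho>\<close> is monotone, differences of \<open>z\<close> give the bound. Uniqueness of the
  modes is a Volterra iteration.\<close>

section \<open>Fractional integrals and Mittag-Leffler series\<close>

text \<open>The exponent 2 comes from a cancellation. In general E_{\<rho>,b}(-x) behaves like 1 /
  (Gamma(b - \<rho>) x), but for b = \<rho> this term drops out because 1 / Gamma vanishes at 0, and
  decay of order x^(-2) remains. A mode with value Phi_k at time T thus has amplitude c_k of exact
  size lambda_k^2 |Phi_k|, so the amplitudes are square summable exactly for Phi in D(A^2), and both
  inequalities of the theorem become one comparison of coefficients. The cancellation is also the
  obstacle to direct estimates: the Volterra equations only see decay of order 1/x. Hence the detour
  through z, whose decay is of that order and whose derivative is the function wanted. For the lower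
  bound z(x) is compared with z(M x), where M is so large that the two values cannot cancel. Nothing
  is prescribed at t = 0, where u may blow up like t^(\<rho>-1). The equation is therefore
  integrated once, which leaves one free constant per mode; this constant is fixed at T because e is
  positive there.\<close>

definition rl_kernel :: "real \<Rightarrow> real \<Rightarrow> real" where
  "rl_kernel a t = t powr (a - 1) / Gamma a"

definition rl_integrable :: "real \<Rightarrow> (real \<Rightarrow> real) \<Rightarrow> real \<Rightarrow> bool" where
  "rl_integrable a f t \<longleftrightarrow> set_integrable lborel {0<..<t} (\<lambda>s. rl_kernel a (t - s) * f s)"

text \<open>On real functions, \<open>rl_int a\<close> is the fractional integral of order \<open>- a\<close>.\<close>

definition rl_int :: "real \<Rightarrow> (real \<Rightarrow> real) \<Rightarrow> real \<Rightarrow> real" where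
  "rl_int a f t = (LBINT s:{0<..<t}. rl_kernel a (t - s) * f s)"

lemma rl_kernel_nonneg: "a > 0 \<Longrightarrow> rl_kernel a t \<ge> 0"
  by (simp add: rl_kernel_def Gamma_real_pos less_imp_le)

lemma rl_kernel_pos: "a > 0 \<Longrightarrow> t > 0 \<Longrightarrow> rl_kernel a t > 0"
  by (simp add: rl_kernel_def Gamma_real_pos)

lemma rl_kernel_1: "t > 0 \<Longrightarrow> rl_kernel 1 t = 1"
  by (simp add: rl_kernel_def)

lemma rl_kernel_measurable [measurable]: "rl_kernel a \<in> borel_measurable borel"
  unfolding rl_kernel_def by measurable

text \<open>The substitution s = t x turns the convolution into a Beta integral. The factor 1 /
  Gamma is the normalization that makes the kernels a semigroup under convolution.\<close>

lemma rl_kernel_conv: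
  assumes a: "a > 0" and b: "b > 0" and t: "t > 0"
  shows "rl_integrable a (rl_kernel b) t" and "rl_int a (rl_kernel b) t = rl_kernel (a + b) t"
proof -
  let ?g = "\<lambda>x. x powr (b - 1) * (1 - x) powr (a - 1) :: real"
  let ?G = "\<lambda>x. indicator {0<..<1} x * ?g x"
  let ?F = "\<lambda>s. indicator {0<..<t} s * (rl_kernel a (t - s) * rl_kernel b s)"
  have int: "set_integrable lborel {0<..<1} ?g"
    by (rule set_integrable_subset[OF integrable_Beta[OF b a]]) auto
  have "(LBINT x:{0<..<1}. ?g x) = integral {0<..<1} ?g"
    by (rule set_borel_integral_eq_integral(2)[OF int])
  also have "\<dots> = Beta b a"
    using has_integral_Beta_real[OF b a]
    by (intro integral_unique) (simp add: has_integral_Icc_iff_Ioo)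
  finally have val: "(\<integral>x. ?G x \<partial>lborel) = Beta b a"
    by (simp add: set_lebesgue_integral_def)
  have scale: "?F (0 + t * x) = (t powr (a + b - 2) / (Gamma a * Gamma b)) * ?G x" for x
  proof (cases "0 < x \<and> x < 1")
    case True
    have "t - t * x = t * (1 - x)" by (simp add: algebra_simps)
    moreover have "t * x < t" using True t by simp
    ultimately show ?thesis
      using True t
      by (simp add: rl_kernel_def powr_mult indicator_def mult_ac flip: powr_add)
  next
    case False
    then have "\<not> (0 < t * x \<and> t * x < t)" using t
      by (metis mult.right_neutral mult_less_cancel_left_pos zero_less_mult_iff not_less_iff_gr_or_eq)
    with False show ?thesis by (auto simp: indicator_def)
  qed
  have Gi: "integrable lborel ?G"
    using int by (simp add: set_integrable_def)
  have "integrable lborel (\<lambda>x. ?F (0 + t * x))"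
    unfolding scale using Gi by (intro integrable_mult_right)
  then show "rl_integrable a (rl_kernel b) t"
    using t lborel_integrable_real_affine_iff[of t ?F 0]
    by (simp add: rl_integrable_def set_integrable_def)
  have "(\<integral>s. ?F s \<partial>lborel) = \<bar>t\<bar> *\<^sub>R (\<integral>x. ?F (0 + t * x) \<partial>lborel)"
    using t by (intro lborel_integral_real_affine) auto
  also have "\<dots> = t * ((t powr (a + b - 2) / (Gamma a * Gamma b)) * Beta b a)"
    unfolding scale using t val by (simp only: integral_mult_right_zero) simp
  also have "\<dots> = rl_kernel (a + b) t"
  proof -
    have "t * t powr (a + b - 2) = t powr (a + b - 1)"
      using t by (simp add: powr_mult_base)
    moreover have "Gamma a \<noteq> 0" "Gamma b \<noteq> 0" "Gamma (a + b) \<noteq> 0"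
      using Gamma_real_pos[OF a] Gamma_real_pos[OF b] Gamma_real_pos[of "a + b"] a b by linarith+
    ultimately show ?thesis
      by (simp add: rl_kernel_def Beta_def add.commute field_simps)
  qed
  finally show "rl_int a (rl_kernel b) t = rl_kernel (a + b) t"
    by (simp add: rl_int_def set_lebesgue_integral_def)
qed

text \<open>Log-convexity of Gamma between \<open>x + r\<close> and \<open>x + r + 1\<close>, where
  \<open>x + 1\<close> has the weights \<open>r\<close> and \<open>1 - r\<close>. It bounds Gamma(x)
  / Gamma(x + r) by a quantity of order x^(-r), as the ratio test for Mittag-Leffler series needs,
  since consecutive Gamma arguments differ there by less than 1.\<close>

lemma Gamma_shift_le:
  fixes x r :: real
  assumes x: "x > 0" and r: "0 < r" "r \<le> 1"
  shows "x * Gamma x \<le> Gamma (x + r) * (x + r) powr (1 - r)"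
proof -
  have "(ln \<circ> Gamma) ((1 - (1 - r)) *\<^sub>R (x + r) + (1 - r) *\<^sub>R (x + r + 1))
      \<le> (1 - (1 - r)) * (ln \<circ> Gamma) (x + r) + (1 - r) * (ln \<circ> Gamma) (x + r + 1)"
    using x r by (intro convex_onD[OF log_convex_Gamma_real]) auto
  moreover have "(1 - (1 - r)) *\<^sub>R (x + r) + (1 - r) *\<^sub>R (x + r + 1) = x + 1"
    by (simp add: algebra_simps)
  moreover have G: "Gamma (x + 1) = x * Gamma x" "Gamma (x + r + 1) = (x + r) * Gamma (x + r)"
    using x r Gamma_plus1[of x] Gamma_plus1[of "x + r"]
    by (auto simp: nonpos_Ints_def add.commute dest!: sym[of _ "of_int _"])
  ultimately have "ln (x * Gamma x) \<le> r * ln (Gamma (x + r)) + (1 - r) * ln ((x + r) * Gamma (x + r))"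
    by simp
  also have "\<dots> = ln (Gamma (x + r) * (x + r) powr (1 - r))"
  proof -
    have g: "Gamma (x + r) > 0" using x r by (intro Gamma_real_pos) auto
    have "ln ((x + r) * Gamma (x + r)) = ln (x + r) + ln (Gamma (x + r))"
      using x r g by (intro ln_mult_pos) auto
    moreover have "ln (Gamma (x + r) * (x + r) powr (1 - r)) = ln (Gamma (x + r)) + (1 - r) * ln (x + r)"
      using x r g by (subst ln_mult_pos) (auto simp: ln_powr)
    ultimately show ?thesis by (simp add: algebra_simps)
  qed
  finally show ?thesis
    using x r by (subst (asm) ln_le_cancel_iff) (auto simp: Gamma_real_pos intro!: mult_pos_pos)
qed

text \<open>The coefficients are general because, besides (-l)^n, the derivative brings in (n + 1)
  (-1)^n. A geometric bound |c n| \<le> R^n covers both and already gives convergence for every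
  argument.\<close>

definition ml_series :: "real \<Rightarrow> real \<Rightarrow> (nat \<Rightarrow> real) \<Rightarrow> real \<Rightarrow> real" where
  "ml_series \<rho> b c x = (\<Sum>n. c n / Gamma (\<rho> * n + b) * x ^ n)"

text \<open>\<open>ml_fun \<rho> b c\<close> is the series of the \<open>c n * rl_kernel (\<rho> * n + b)\<close>; fractional integration of order
  \<open>- a\<close> turns \<open>b\<close> into \<open>a + b\<close>.\<close>

definition ml_fun :: "real \<Rightarrow> real \<Rightarrow> (nat \<Rightarrow> real) \<Rightarrow> real \<Rightarrow> real" where
  "ml_fun \<rho> b c t = t powr (b - 1) * ml_series \<rho> b c (t powr \<rho>)"

lemma summable_ml_series:
  fixes c :: "nat \<Rightarrow> real" and \<rho> b R :: real
  assumes rho: "0 < \<rho>" "\<rho> < 1" and b: "b > 0" and c: "\<And>n. \<bar>c n\<bar> \<le> R ^ n"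
  shows "summable (\<lambda>n. \<bar>c n / Gamma (\<rho> * n + b) * x ^ n\<bar>)"
proof -
  \<comment> \<open>The summand 1 keeps \<open>y\<close> positive even if R x = 0, so powers of
    \<open>y\<close> can be used as positive factors in the ratio test.\<close>
  define y where "y = \<bar>R\<bar> * \<bar>x\<bar> + 1"
  have y: "y > 0" unfolding y_def by (intro add_nonneg_pos) auto
  have pos: "\<rho> * real n + b > 0" for n using rho b by (simp add: add_nonneg_pos)
  have frac: "1 / G \<le> p / z * (1 / g)" if "z > 0" "g > 0" "G > 0" "z * g \<le> G * p" for z g G p :: real
    using that by (simp add: field_simps)
  have "(\<lambda>n. y * ((\<rho> * real n + b + \<rho>) powr (1 - \<rho>) / (\<rho> * real n + b))) \<longlonglongrightarrow> 0"
  proof -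
    have shift: "filterlim (\<lambda>z::real. z + \<rho>) at_top at_top" by real_asymp
    \<comment> \<open>The quotient (z + \<rho>)^(1-\<rho>) / z is split as (1 + \<rho>/z) (z +
      \<rho>)^(-\<rho>): a factor tending to 1 times a factor tending to 0.\<close>
    have lim: "((\<lambda>z::real. y * ((1 + \<rho> / z) * (z + \<rho>) powr (-\<rho>))) \<longlongrightarrow> y * ((1 + 0) * 0)) at_top"
      by (intro tendsto_intros tendsto_divide_0[OF tendsto_const] tendsto_neg_powr
          filterlim_at_top_imp_at_infinity filterlim_ident
          shift) (use rho in auto)
    have "\<forall>\<^sub>F z::real in at_top. y * ((1 + \<rho> / z) * (z + \<rho>) powr (-\<rho>)) = y * ((z + \<rho>) powr (1 - \<rho>) / z)"
      using eventually_gt_at_top[of 0]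
    proof eventually_elim
      case (elim z)
      have "(z + \<rho>) powr (1 - \<rho>) = (z + \<rho>) * (z + \<rho>) powr (-\<rho>)"
        using elim rho by (simp add: powr_mult_base)
      then show ?case using elim by (simp add: field_simps)
    qed
    from Lim_transform_eventually[OF lim this]
    have "((\<lambda>z. y * ((z + \<rho>) powr (1 - \<rho>) / z)) \<longlongrightarrow> 0) at_top" by simp
    moreover have "filterlim (\<lambda>n. \<rho> * real n + b) at_top sequentially"
      using rho by real_asymp
    ultimately show ?thesis by (rule filterlim_compose)
  qed
  from order_tendstoD(2)[OF this, of "1/2"]
  obtain N where N: "\<And>n. n \<ge> N \<Longrightarrow> y * ((\<rho> * real n + b + \<rho>) powr (1 - \<rho>) / (\<rho> * real n + b)) < 1/2"
    by (auto simp: eventually_sequentially)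
  have "summable (\<lambda>n. y ^ n / Gamma (\<rho> * n + b))"
  proof (rule summable_ratio_test[of "1/2" N])
    fix n assume n: "n \<ge> N"
    let ?z = "\<rho> * real n + b"
    have z: "?z > 0" by (rule pos)
    have G: "Gamma ?z > 0" "Gamma (?z + \<rho>) > 0" using z rho by (auto intro!: Gamma_real_pos)
    have "?z * Gamma ?z \<le> Gamma (?z + \<rho>) * (?z + \<rho>) powr (1 - \<rho>)"
      using Gamma_shift_le[OF z, of \<rho>] rho by simp
    then have "1 / Gamma (?z + \<rho>) \<le> (?z + \<rho>) powr (1 - \<rho>) / ?z * (1 / Gamma ?z)"
      using z G by (intro frac) auto
    then have "y * (1 / Gamma (?z + \<rho>)) \<le> y * ((?z + \<rho>) powr (1 - \<rho>) / ?z * (1 / Gamma ?z))"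
      using y by (intro mult_left_mono) auto
    also have "\<dots> = (y * ((?z + \<rho>) powr (1 - \<rho>) / ?z)) * (1 / Gamma ?z)" by simp
    also have "\<dots> \<le> 1/2 * (1 / Gamma ?z)"
      using N[OF n] G by (intro mult_right_mono) auto
    finally have "y ^ n * (y * (1 / Gamma (?z + \<rho>))) \<le> y ^ n * (1/2 * (1 / Gamma ?z))"
      using y by (intro mult_left_mono) auto
    moreover have eq: "\<rho> * real (Suc n) + b = ?z + \<rho>" by (simp add: algebra_simps)
    ultimately show "norm (y ^ Suc n / Gamma (\<rho> * real (Suc n) + b)) \<le> 1/2 * norm (y ^ n / Gamma ?z)"
      unfolding eq using y G by (simp add: mult.commute)
  qed simp
  then show ?thesis
  proof (rule summable_comparison_test'[of _ 0])
    fix n :: nat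
    have G: "Gamma (\<rho> * n + b) > 0" by (rule Gamma_real_pos[OF pos])
    have "\<bar>c n\<bar> * \<bar>x\<bar> ^ n \<le> \<bar>R\<bar> ^ n * \<bar>x\<bar> ^ n"
      using c[of n] by (intro mult_right_mono) (auto simp flip: power_abs)
    also have "\<dots> = (\<bar>R\<bar> * \<bar>x\<bar>) ^ n" by (simp add: power_mult_distrib)
    also have "\<dots> \<le> y ^ n" unfolding y_def by (intro power_mono) auto
    finally show "norm \<bar>c n / Gamma (\<rho> * n + b) * x ^ n\<bar> \<le> y ^ n / Gamma (\<rho> * n + b)"
      using G by (simp add: abs_mult power_abs divide_right_mono)
  qed
qed

lemma continuous_on_ml_series:
  fixes c :: "nat \<Rightarrow> real" and \<rho> b R :: real
  assumes rho: "0 < \<rho>" "\<rho> < 1" and b: "b > 0" and c: "\<And>n. \<bar>c n\<bar> \<le> R ^ n"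
  shows "continuous_on A (ml_series \<rho> b c)"
proof (rule continuous_at_imp_continuous_on, rule ballI)
  fix x :: real
  have "summable (\<lambda>n. c n / Gamma (\<rho> * n + b) * (\<bar>x\<bar> + 1) ^ n)"
    by (rule summable_rabs_cancel[OF summable_ml_series[OF assms]])
  then show "isCont (ml_series \<rho> b c) x"
    unfolding ml_series_def by (rule isCont_powser) simp
qed

lemma continuous_on_ml_fun:
  fixes c :: "nat \<Rightarrow> real" and \<rho> b R :: real
  assumes rho: "0 < \<rho>" "\<rho> < 1" and b: "b > 0" and c: "\<And>n. \<bar>c n\<bar> \<le> R ^ n"
  shows "continuous_on {0<..} (ml_fun \<rho> b c)"
  unfolding ml_fun_def
  by (intro continuous_intros continuous_on_compose2[OF continuous_on_ml_series[OF assms, of UNIV]]) auto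

lemma ml_fun_sums:
  fixes c :: "nat \<Rightarrow> real" and \<rho> b R :: real
  assumes rho: "0 < \<rho>" "\<rho> < 1" and b: "b > 0" and c: "\<And>n. \<bar>c n\<bar> \<le> R ^ n" and t: "t > 0"
  shows "(\<lambda>n. c n * rl_kernel (\<rho> * n + b) t) sums ml_fun \<rho> b c t"
    and "summable (\<lambda>n. \<bar>c n * rl_kernel (\<rho> * n + b) t\<bar>)"
proof -
  have eq: "c n * rl_kernel (\<rho> * n + b) t
      = t powr (b - 1) * (c n / Gamma (\<rho> * n + b) * (t powr \<rho>) ^ n)" for n
  proof -
    have "t powr (\<rho> * n + b - 1) = t powr (b - 1) * (t powr \<rho>) ^ n"
      using t by (simp add: powr_powr algebra_simps flip: powr_add powr_realpow)
    then show ?thesis by (simp add: rl_kernel_def)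
  qed
  note S = summable_ml_series[where x="t powr \<rho>", OF rho b c]
  show "(\<lambda>n. c n * rl_kernel (\<rho> * n + b) t) sums ml_fun \<rho> b c t"
    unfolding eq ml_fun_def ml_series_def
    by (intro sums_mult summable_sums summable_rabs_cancel[OF S])
  show "summable (\<lambda>n. \<bar>c n * rl_kernel (\<rho> * n + b) t\<bar>)"
    unfolding eq abs_mult[of "t powr (b - 1)"] by (intro summable_mult S)
qed

text \<open>Termwise integration. All kernels are nonnegative, so the integrals of the absolute
  values are the terms of the series for \<open>a + b\<close> with coefficients |c n|; its
  convergence is what exchanging sum and integral requires.\<close>

lemma rl_int_ml_fun:
  fixes c :: "nat \<Rightarrow> real" and \<rho> b R :: real
  assumes rho: "0 < \<rho>" "\<rho> < 1" and a: "a > 0" and b: "b > 0" and c: "\<And>n. \<bar>c n\<bar> \<le> R ^ n"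
    and t: "t > 0"
  shows "rl_integrable a (ml_fun \<rho> b c) t" and "rl_int a (ml_fun \<rho> b c) t = ml_fun \<rho> (a + b) c t"
proof -
  have pos: "\<rho> * real n + b > 0" for n using rho b by (simp add: add_nonneg_pos)
  define f where "f n s = indicator {0<..<t} s *\<^sub>R (rl_kernel a (t - s) * (c n * rl_kernel (\<rho> * real n + b) s))"
    for n s
  have f_eq: "f n s = c n * (indicator {0<..<t} s *\<^sub>R (rl_kernel a (t - s) * rl_kernel (\<rho> * real n + b) s))"
    for n s by (simp add: f_def)
  have int0: "integrable lborel (\<lambda>s. indicator {0<..<t} s *\<^sub>R (rl_kernel a (t - s) * rl_kernel (\<rho> * real n + b) s))"
    for n using rl_kernel_conv(1)[OF a pos t] by (simp add: rl_integrable_def set_integrable_def)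
  have int: "integrable lborel (f n)" for n
    unfolding f_eq by (intro integrable_mult_right int0)
  have val0: "(\<integral>s. indicator {0<..<t} s *\<^sub>R (rl_kernel a (t - s) * rl_kernel (\<rho> * real n + b) s) \<partial>lborel)
      = rl_kernel (\<rho> * real n + (a + b)) t" for n
    using rl_kernel_conv(2)[OF a pos t, of n]
    by (simp add: rl_int_def set_lebesgue_integral_def add_ac)
  have val: "(\<integral>s. f n s \<partial>lborel) = c n * rl_kernel (\<rho> * real n + (a + b)) t" for n
    unfolding f_eq by (subst integral_mult_right_zero, subst val0) simp
  have absf: "norm (f n s) = \<bar>c n\<bar> * (indicator {0<..<t} s *\<^sub>R (rl_kernel a (t - s) * rl_kernel (\<rho> * real n + b) s))"
    for n s using rl_kernel_nonneg[OF pos] rl_kernel_nonneg[OF a]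
    by (simp add: f_eq abs_mult indicator_def)
  have valabs: "(\<integral>s. norm (f n s) \<partial>lborel) = \<bar>c n\<bar> * rl_kernel (\<rho> * real n + (a + b)) t" for n
    unfolding absf by (subst integral_mult_right_zero, subst val0) simp
  have ab: "a + b > 0" using a b by simp
  have pos': "\<rho> * real n + (a + b) > 0" for n using pos[of n] a by simp
  have sum1: "AE s in lborel. summable (\<lambda>n. norm (f n s))"
  proof (rule AE_I2)
    fix s show "summable (\<lambda>n. norm (f n s))"
    proof (cases "0 < s \<and> s < t")
      case True
      then have "norm (f n s) = rl_kernel a (t - s) * \<bar>c n * rl_kernel (\<rho> * real n + b) s\<bar>" for n
        using rl_kernel_nonneg[OF a] by (simp add: f_def abs_mult)
      then show ?thesis
        using ml_fun_sums(2)[OF rho b c, of s] True by (simp add: summable_mult)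
    qed (auto simp: f_def)
  qed
  have sum2: "summable (\<lambda>n. \<integral>s. norm (f n s) \<partial>lborel)"
    unfolding valabs using ml_fun_sums(2)[OF rho ab c t] rl_kernel_nonneg[OF pos']
    by (simp add: abs_mult)
  have lim: "(\<Sum>n. f n s) = indicator {0<..<t} s *\<^sub>R (rl_kernel a (t - s) * ml_fun \<rho> b c s)" for s
  proof (cases "0 < s \<and> s < t")
    case True
    have "(\<lambda>n. rl_kernel a (t - s) * (c n * rl_kernel (\<rho> * real n + b) s)) sums
        (rl_kernel a (t - s) * ml_fun \<rho> b c s)"
      using True by (intro sums_mult ml_fun_sums(1)[OF rho b c]) auto
    then show ?thesis using True by (simp add: f_def sums_iff)
  qed (auto simp: f_def)
  have "integrable lborel (\<lambda>s. \<Sum>n. f n s)"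
    by (rule integrable_suminf[OF int sum1 sum2])
  then show "rl_integrable a (ml_fun \<rho> b c) t"
    unfolding lim rl_integrable_def set_integrable_def .
  have "(\<integral>s. (\<Sum>n. f n s) \<partial>lborel) = (\<Sum>n. \<integral>s. f n s \<partial>lborel)"
    by (rule integral_suminf[OF int sum1 sum2])
  also have "\<dots> = ml_fun \<rho> (a + b) c t"
    unfolding val using ml_fun_sums(1)[OF rho ab c t] by (simp add: sums_iff)
  finally show "rl_int a (ml_fun \<rho> b c) t = ml_fun \<rho> (a + b) c t"
    unfolding lim rl_int_def set_lebesgue_integral_def .
qed

lemma rl_kernel_conv_shift:
  assumes a: "0 < a" and b: "0 < b" and st: "s < t"
  shows "integrable lborel (\<lambda>x. indicator {s<..<t} x * (rl_kernel a (t - x) * rl_kernel b (x - s)))"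
    and "(\<integral>x. indicator {s<..<t} x * (rl_kernel a (t - x) * rl_kernel b (x - s)) \<partial>lborel) = rl_kernel (a + b) (t - s)"
proof -
  let ?F = "\<lambda>x. indicator {s<..<t} x * (rl_kernel a (t - x) * rl_kernel b (x - s))"
  have sc: "?F (s + 1 * x) = indicator {0<..<t - s} x * (rl_kernel a ((t - s) - x) * rl_kernel b x)" for x
    by (auto simp: indicator_def algebra_simps)
  have ts: "t - s > 0" using st by simp
  note C = rl_kernel_conv[OF a b ts, unfolded rl_integrable_def set_integrable_def
      rl_int_def set_lebesgue_integral_def real_scaleR_def]
  have "integrable lborel (\<lambda>x. ?F (s + 1 * x))"
    unfolding sc by (rule C(1))
  then show "integrable lborel ?F"
    using lborel_integrable_real_affine_iff[of 1 ?F s] by simp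
  have "(\<integral>x. ?F x \<partial>lborel) = \<bar>1\<bar> *\<^sub>R (\<integral>x. ?F (s + 1 * x) \<partial>lborel)"
    by (intro lborel_integral_real_affine) auto
  also have "\<dots> = rl_kernel (a + b) (t - s)"
    unfolding sc using C(2) by simp
  finally show "(\<integral>x. ?F x \<partial>lborel) = rl_kernel (a + b) (t - s)" .
qed

section \<open>Positivity and decay of Mittag-Leffler functions\<close>

text \<open>Since a - 1 is negative, the claim reduces to t0 (t - s) \<le> (t0 - s) t, that is s t
  \<le> s t0.\<close>

lemma rl_kernel_ratio_mono:
  assumes a: "0 < a" "a < 1" and st: "0 < s" "s < t" "t \<le> t0"
  shows "rl_kernel a (t0 - s) * rl_kernel a t \<le> rl_kernel a t0 * rl_kernel a (t - s)"
proof -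
  have le: "t0 * (t - s) \<le> (t0 - s) * t"
    using st by (simp add: algebra_simps mult_right_mono)
  have "((t0 - s) * t) powr (a - 1) \<le> (t0 * (t - s)) powr (a - 1)"
    using le st a by (intro powr_mono2') auto
  then show ?thesis
    using st by (simp add: rl_kernel_def powr_mult divide_simps)
qed

text \<open>The constant 1 is \<open>rl_kernel 1\<close>, so the mass of the kernel next to its
  singularity is again a convolution of two kernels.\<close>

lemma rl_kernel_tail:
  assumes a: "0 < a" and st: "s < t"
  shows "set_integrable lborel {s<..<t} (\<lambda>x. rl_kernel a (t - x))"
    and "(LBINT x:{s<..<t}. rl_kernel a (t - x)) = rl_kernel (a + 1) (t - s)"
proof -
  have "indicator {s<..<t} x * (rl_kernel a (t - x) * rl_kernel 1 (x - s)) = indicator {s<..<t} x * rl_kernel a (t - x)" for x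
    by (simp add: indicator_def rl_kernel_1)
  with rl_kernel_conv_shift[OF a zero_less_one st]
  show "set_integrable lborel {s<..<t} (\<lambda>x. rl_kernel a (t - x))"
    and "(LBINT x:{s<..<t}. rl_kernel a (t - x)) = rl_kernel (a + 1) (t - s)"
    by (simp_all add: set_integrable_def set_lebesgue_integral_def)
qed

text \<open>At a first zero \<open>t0\<close> of \<open>f\<close>, compare the equation at \<open>t0\<close> with the one at a point \<open>s\<close> where \<open>f\<close> is
  maximal on a short interval before \<open>t0\<close>: the ratio \<open>rl_kernel a (t0 - r) / rl_kernel a (s - r)\<close> is
  largest at \<open>r = 0\<close>, because the kernel is log-convex.\<close>

lemma volterra_positive:
  fixes f g :: "real \<Rightarrow> real"
  assumes a: "0 < a" "a < 1"
    and cont: "continuous_on {0<..} f"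
    and near0: "d > 0" "\<And>t. 0 < t \<Longrightarrow> t < d \<Longrightarrow> f t > 0"
    and int: "\<And>t. t > 0 \<Longrightarrow> rl_integrable a f t"
    and eq: "\<And>t. t > 0 \<Longrightarrow> f t + rl_int a f t = g t"
    and mono: "\<And>s t. 0 < s \<Longrightarrow> s \<le> t \<Longrightarrow> (\<And>r. 0 < r \<Longrightarrow> r < t \<Longrightarrow> f r > 0) \<Longrightarrow>
      g s * rl_kernel a t \<le> g t * rl_kernel a s"
    and t: "t > 0"
  shows "f t > 0"
proof (rule ccontr)
  assume "\<not> f t > 0"
  \<comment> \<open>The cut-off at \<open>d\<close> keeps the infimum of \<open>N\<close> inside the
    region where \<open>f\<close> is continuous.\<close>
  define N where "N = {r. r \<ge> d \<and> r \<le> t \<and> f r \<le> 0}"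
  have tN: "t \<in> N" using near0(2)[OF t] \<open>\<not> f t > 0\<close> by (auto simp: N_def not_less[symmetric])
  have bN: "bdd_below N" by (auto simp: N_def bdd_below_def)
  have "closed {r \<in> {d..t}. f r \<le> 0}"
    by (rule continuous_on_closed_Collect_le) (use near0(1) in \<open>auto intro!: continuous_on_subset[OF cont]\<close>)
  moreover have "N = {r \<in> {d..t}. f r \<le> 0}" by (auto simp: N_def)
  ultimately have clN: "closed N" by simp
  define t0 where "t0 = Inf N"
  have t0N: "t0 \<in> N" unfolding t0_def
    using tN bN clN by (intro closed_contains_Inf) auto
  then have t0: "t0 > 0" "f t0 \<le> 0" "t0 \<le> t" using near0(1) by (auto simp: N_def)
  have fpos: "f r > 0" if r: "0 < r" "r < t0" for r
  proof (rule ccontr)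
    assume n: "\<not> f r > 0"
    then have "r \<ge> d" using near0(2)[of r] r by force
    with n r t0 have "r \<in> N" by (auto simp: N_def)
    then have "t0 \<le> r" unfolding t0_def using bN by (rule cInf_lower)
    with r show False by simp
  qed
  have Ga: "Gamma (a + 1) > 0" using a by (intro Gamma_real_pos) auto
  \<comment> \<open>The length \<open>h\<close> solves \<open>rl_kernel (a + 1) h = 1 / 4\<close>,
    so the part of the integral over (s, t0) costs at most f(s) / 4.\<close>
  define h where "h = (Gamma (a + 1) / 4) powr (1 / a)"
  have h: "h > 0" using Ga by (simp add: h_def)
  \<comment> \<open>Staying beyond t0 / 2 gives k(t0) / k(s) \<ge> 2^(a-1) \<ge> 1/2, which exceeds
    the 1/4 lost on (s, t0).\<close>
  define t1 where "t1 = max (t0 / 2) (t0 - h)"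
  have t1: "0 < t1" "t1 < t0" using t0 h by (auto simp: t1_def)
  have "continuous_on {t1..t0} f" using t1 by (intro continuous_on_subset[OF cont]) auto
  then obtain s where s: "s \<in> {t1..t0}" and smax: "\<And>r. r \<in> {t1..t0} \<Longrightarrow> f r \<le> f s"
    using continuous_attains_sup[of "{t1..t0}" f] t1 by auto
  have "f s > 0" using smax[of t1] fpos[of t1] t1 by auto
  then have s_lt: "s < t0" using s t0 by (cases "s = t0") auto
  have s0: "s > 0" using s t1 by simp
  let ?k = "rl_kernel a"
  have kpos: "?k r > 0" if "r > 0" for r using rl_kernel_pos a that by blast
  have int0: "set_integrable lborel {0<..<t0} (\<lambda>r. ?k (t0 - r) * f r)"
    using int[OF t0(1)] by (simp add: rl_integrable_def)
  have ints: "set_integrable lborel {0<..<s} (\<lambda>r. ?k (s - r) * f r)"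
    using int[OF s0] by (simp add: rl_integrable_def)
  have i1: "set_integrable lborel {0<..<s} (\<lambda>r. ?k (t0 - r) * f r)"
    by (rule set_integrable_subset[OF int0]) (use s_lt in auto)
  have i2: "set_integrable lborel {s..<t0} (\<lambda>r. ?k (t0 - r) * f r)"
    by (rule set_integrable_subset[OF int0]) (use s0 in auto)
  have i3: "set_integrable lborel {s<..<t0} (\<lambda>r. ?k (t0 - r) * f r)"
    by (rule set_integrable_subset[OF int0]) (use s0 in auto)
  have "{0<..<t0} = {0<..<s} \<union> {s..<t0}" using s0 s_lt by auto
  then have "rl_int a f t0 = (LBINT r:{0<..<s}. ?k (t0 - r) * f r) + (LBINT r:{s..<t0}. ?k (t0 - r) * f r)"
    unfolding rl_int_def by (simp only:) (rule set_integral_Un[OF _ i1 i2], auto)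
  also have "(LBINT r:{s..<t0}. ?k (t0 - r) * f r) = (LBINT r:{s<..<t0}. ?k (t0 - r) * f r)"
  proof (rule set_integral_cong_set)
    show "AE x in lborel. (x \<in> {s<..<t0}) = (x \<in> {s..<t0})"
      using AE_lborel_singleton[of s] by eventually_elim auto
  qed (use i2 i3 in \<open>auto simp: set_borel_measurable_def set_integrable_def\<close>)
  also have "\<dots> \<le> (LBINT r:{s<..<t0}. ?k (t0 - r) * f s)"
  proof (rule set_integral_mono[OF i3])
    show "set_integrable lborel {s<..<t0} (\<lambda>r. ?k (t0 - r) * f s)"
      using rl_kernel_tail(1)[OF a(1) s_lt] by (rule set_integrable_mult_left)
    fix r assume "r \<in> {s<..<t0}"
    then show "?k (t0 - r) * f r \<le> ?k (t0 - r) * f s"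
      using smax[of r] s kpos[of "t0 - r"] by (intro mult_left_mono) auto
  qed
  also have "\<dots> = rl_kernel (a + 1) (t0 - s) * f s"
    using rl_kernel_tail(2)[OF a(1) s_lt] by simp
  also have "(LBINT r:{0<..<s}. ?k (t0 - r) * f r) \<le> (LBINT r:{0<..<s}. ?k t0 / ?k s * (?k (s - r) * f r))"
  proof (rule set_integral_mono[OF i1])
    show "set_integrable lborel {0<..<s} (\<lambda>r. ?k t0 / ?k s * (?k (s - r) * f r))"
      using ints by (rule set_integrable_mult_right)
    fix r assume r: "r \<in> {0<..<s}"
    then have "?k (t0 - r) * ?k s \<le> ?k t0 * ?k (s - r)"
      using rl_kernel_ratio_mono[OF a, of r s t0] s_lt by auto
    then have "?k (t0 - r) \<le> ?k t0 / ?k s * ?k (s - r)"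
      using kpos[OF s0] by (simp add: field_simps)
    then have "?k (t0 - r) * f r \<le> ?k t0 / ?k s * ?k (s - r) * f r"
      using fpos[of r] r s_lt by (intro mult_right_mono) auto
    then show "?k (t0 - r) * f r \<le> ?k t0 / ?k s * (?k (s - r) * f r)"
      by (simp only: mult.assoc)
  qed
  also have "\<dots> = ?k t0 / ?k s * rl_int a f s"
    unfolding rl_int_def by (rule set_integral_mult_right)
  also have "\<dots> = ?k t0 / ?k s * (g s - f s)"
    using eq[OF s0] by (simp add: eq_diff_eq add.commute)
  finally have bound: "rl_int a f t0 \<le> ?k t0 / ?k s * (g s - f s) + rl_kernel (a + 1) (t0 - s) * f s"
    by simp
  have "g s * ?k t0 \<le> g t0 * ?k s"
    by (rule mono) (use s0 s_lt fpos in auto)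
  then have g: "g t0 - ?k t0 / ?k s * g s \<ge> 0"
    using kpos[OF s0] by (simp add: field_simps)
  have "?k t0 / ?k s \<ge> 1 / 2"
  proof -
    have "?k t0 / ?k s = (t0 / s) powr (a - 1)"
      using Gamma_real_pos[OF a(1)] by (simp add: rl_kernel_def powr_divide)
    also have "\<dots> \<ge> 2 powr (a - 1)"
      using s s0 t1 t0 a s_lt
      by (intro powr_mono2') (auto simp: t1_def field_simps)
    also have "2 powr (a - 1) \<ge> 2 powr (- 1)" using a by (intro powr_mono) auto
    moreover have "2 powr (- 1) = (1 / 2 :: real)" by (simp add: powr_minus)
    ultimately show ?thesis by linarith
  qed
  moreover have "rl_kernel (a + 1) (t0 - s) \<le> 1 / 4"
  proof -
    have "(t0 - s) powr a \<le> h powr a"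
      using s s_lt a by (intro powr_mono2) (auto simp: t1_def)
    also have "h powr a = Gamma (a + 1) / 4" using a Ga by (simp add: h_def powr_powr)
    finally show ?thesis using Ga by (simp add: rl_kernel_def field_simps)
  qed
  ultimately have "(?k t0 / ?k s - rl_kernel (a + 1) (t0 - s)) * f s > 0"
    using \<open>f s > 0\<close> by (intro mult_pos_pos) auto
  \<comment> \<open>Both equations are combined with weight q = k(t0) / k(s). The bracket with
    \<open>g\<close> is nonnegative by the monotonicity of g / k, and the multiple of f(s) is
    positive, against f(t0) \<le> 0.\<close>
  moreover have "f t0 \<ge> (g t0 - ?k t0 / ?k s * g s) + (?k t0 / ?k s - rl_kernel (a + 1) (t0 - s)) * f s"
  proof -
    define q where "q = ?k t0 / ?k s"
    show ?thesis
      using bound eq[OF t0(1)] unfolding q_def[symmetric] by (simp add: algebra_simps)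
  qed
  ultimately show False using g t0 by linarith
qed

section \<open>Functional equations, derivatives and signs of Mittag-Leffler functions\<close>

text \<open>In the usual notation \<open>mlneg \<rho> b x\<close> is \<open>E\<^bsub>\<rho>,b\<^esub>(- x)\<close>.\<close>

abbreviation mlneg :: "real \<Rightarrow> real \<Rightarrow> real \<Rightarrow> real" where
  "mlneg \<rho> b \<equiv> ml_series \<rho> b (\<lambda>n. (- 1) ^ n)"

lemma ml_series_scale: "ml_series \<rho> b (\<lambda>n. (- l) ^ n) x = mlneg \<rho> b (l * x)"
proof -
  have "(- l) ^ n / G * x ^ n = (- 1) ^ n / G * (l * x) ^ n" for n and G :: real
    by (simp add: power_minus[of l] power_mult_distrib)
  then show ?thesis unfolding ml_series_def by (simp only:)
qed

text \<open>The n-th term at \<open>b + \<rho>\<close> carries the same kernel as term n + 1 at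
  \<open>b\<close>. Equations between the two functions thus become relations between
  \<open>c (Suc n)\<close> and \<open>d n\<close>.\<close>

lemma ml_fun_shift:
  fixes \<rho> b R :: real
  assumes rho: "0 < \<rho>" "\<rho> < 1" and b: "b > 0" and c: "\<And>n. \<bar>c n\<bar> \<le> R ^ n"
    and d: "\<And>n. \<bar>d n\<bar> \<le> R' ^ n" and t: "t > 0"
  shows "ml_fun \<rho> b c t + m * ml_fun \<rho> (b + \<rho>) d t = c 0 * rl_kernel b t +
    (\<Sum>n. (c (Suc n) + m * d n) * rl_kernel (\<rho> * n + (b + \<rho>)) t)"
proof -
  have "(\<lambda>n. c (Suc n) * rl_kernel (\<rho> * Suc n + b) t) sums (ml_fun \<rho> b c t - c 0 * rl_kernel b t)"
    using ml_fun_sums(1)[OF rho b c t] by (subst sums_Suc_iff) simp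
  moreover have "\<rho> * real (Suc n) + b = \<rho> * n + (b + \<rho>)" for n by (simp add: algebra_simps)
  ultimately have "(\<lambda>n. c (Suc n) * rl_kernel (\<rho> * n + (b + \<rho>)) t) sums (ml_fun \<rho> b c t - c 0 * rl_kernel b t)"
    by (simp only:)
  moreover have "(\<lambda>n. m * (d n * rl_kernel (\<rho> * n + (b + \<rho>)) t)) sums (m * ml_fun \<rho> (b + \<rho>) d t)"
    using rho b by (intro sums_mult ml_fun_sums(1)[OF rho _ d t]) auto
  ultimately have "(\<lambda>n. c (Suc n) * rl_kernel (\<rho> * n + (b + \<rho>)) t + m * (d n * rl_kernel (\<rho> * n + (b + \<rho>)) t))
      sums (ml_fun \<rho> b c t - c 0 * rl_kernel b t + m * ml_fun \<rho> (b + \<rho>) d t)"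
    by (rule sums_add)
  then show ?thesis by (simp add: sums_iff distrib_right mult.assoc)
qed

lemma neg_power_bound: "\<bar>(- l) ^ n\<bar> \<le> \<bar>l\<bar> ^ n" for l :: real
  by (simp add: power_abs)

lemma neg_one_power_bound: "\<bar>(- 1) ^ n\<bar> \<le> (1 :: real) ^ n"
  by simp

lemma Suc_neg_power_bound: "\<bar>real (Suc n) * (- 1) ^ n\<bar> \<le> 2 ^ n"
proof -
  have "real (Suc n) \<le> 2 ^ n" by (induction n) auto
  then show ?thesis by (simp add: abs_mult)
qed

text \<open>The coefficients (-l)^(n+1) + l (-l)^n cancel and only the leading kernel survives. By
  \<open>rl_int_ml_fun\<close> this is the Volterra equation with right-hand side k for b = \<rho>,
  and with right-hand side 1 for b = 1.\<close>

lemma ml_fun_resolvent_scaled: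
  assumes rho: "0 < \<rho>" "\<rho> < 1" and b: "b > 0" and t: "t > 0"
  shows "ml_fun \<rho> b (\<lambda>n. (- l) ^ n) t + l * ml_fun \<rho> (b + \<rho>) (\<lambda>n. (- l) ^ n) t = rl_kernel b t"
  by (subst ml_fun_shift[OF rho b neg_power_bound neg_power_bound t]) simp

lemma ml_fun_resolvent:
  assumes rho: "0 < \<rho>" "\<rho> < 1" and b: "b > 0" and t: "t > 0"
  shows "ml_fun \<rho> b (\<lambda>n. (- 1) ^ n) t + ml_fun \<rho> (b + \<rho>) (\<lambda>n. (- 1) ^ n) t = rl_kernel b t"
  using ml_fun_resolvent_scaled[OF assms, of 1] by simp

text \<open>The \<open>d n\<close> are the coefficients of (1 + X)^(-2). Adding the shifted series
  multiplies by 1 + X and leaves those of (1 + X)^(-1).\<close>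

lemma ml_fun_resolvent_deriv:
  assumes rho: "0 < \<rho>" "\<rho> < 1" and b: "b > 0" and t: "t > 0"
  defines "d \<equiv> \<lambda>n. real (Suc n) * (- 1) ^ n"
  shows "ml_fun \<rho> b d t + ml_fun \<rho> (b + \<rho>) d t = ml_fun \<rho> b (\<lambda>n. (- 1) ^ n) t"
proof -
  have "d (Suc n) + d n = - ((- 1) ^ n)" for n by (simp add: d_def algebra_simps)
  moreover have "ml_fun \<rho> b d t + ml_fun \<rho> (b + \<rho>) d t = d 0 * rl_kernel b t +
    (\<Sum>n. (d (Suc n) + d n) * rl_kernel (\<rho> * n + (b + \<rho>)) t)"
    unfolding d_def using ml_fun_shift[OF rho b Suc_neg_power_bound Suc_neg_power_bound t, of 1]
    by (simp only: mult_1)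
  ultimately have "ml_fun \<rho> b d t + ml_fun \<rho> (b + \<rho>) d t = rl_kernel b t +
    (\<Sum>n. - ((- 1) ^ n * rl_kernel (\<rho> * n + (b + \<rho>)) t))"
    by (simp add: d_def)
  also have "(\<lambda>n. - ((- 1) ^ n * rl_kernel (\<rho> * n + (b + \<rho>)) t)) sums
      (- ml_fun \<rho> (b + \<rho>) (\<lambda>n. (- 1) ^ n) t)"
    using rho b by (intro sums_minus ml_fun_sums(1)[OF rho _ neg_one_power_bound t]) auto
  then have "(\<Sum>n. - ((- 1) ^ n * rl_kernel (\<rho> * n + (b + \<rho>)) t)) = - ml_fun \<rho> (b + \<rho>) (\<lambda>n. (- 1) ^ n) t"
    by (simp add: sums_iff)
  finally show ?thesis using ml_fun_resolvent[OF rho b t] by simp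
qed

lemma ml_series_0: "ml_series \<rho> b c 0 = c 0 / Gamma b"
proof -
  have "(\<lambda>n. c n / Gamma (\<rho> * n + b) * 0 ^ n) sums (c 0 / Gamma (\<rho> * real 0 + b))"
    by (rule powser_sums_zero)
  then show ?thesis by (simp add: ml_series_def sums_iff)
qed

lemma ml_series_deriv:
  fixes \<rho> b R :: real
  assumes rho: "0 < \<rho>" "\<rho> < 1" and b: "b > 0" and c: "\<And>n. \<bar>c n\<bar> \<le> R ^ n"
  shows "(ml_series \<rho> b c has_field_derivative
    (\<Sum>n. real (Suc n) * (c (Suc n) / Gamma (\<rho> * Suc n + b)) * x ^ n)) (at x)"
proof -
  let ?a = "\<lambda>n. c n / Gamma (\<rho> * n + b)"
  have "DERIV (\<lambda>x. \<Sum>n. ?a n * x ^ n) x :> (\<Sum>n. diffs ?a n * x ^ n)"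
    by (rule termdiffs_strong_converges_everywhere)
      (rule summable_rabs_cancel[OF summable_ml_series[OF assms]])
  then show ?thesis unfolding ml_series_def[abs_def] by (simp add: diffs_def)
qed

text \<open>The derivative is expressed through the (1 + X)^(-2) coefficients with parameter
  \<open>b + \<rho>\<close>, the form in which it obeys a Volterra equation itself.\<close>

lemma mlneg_deriv:
  assumes rho: "0 < \<rho>" "\<rho> < 1" and b: "b > 0"
  shows "(mlneg \<rho> b has_field_derivative
    - ml_series \<rho> (b + \<rho>) (\<lambda>n. real (Suc n) * (- 1) ^ n) x) (at x)"
proof -
  have "(\<lambda>n. real (Suc n) * (- 1) ^ n / Gamma (\<rho> * n + (b + \<rho>)) * x ^ n) sums
      ml_series \<rho> (b + \<rho>) (\<lambda>n. real (Suc n) * (- 1) ^ n) x"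
    unfolding ml_series_def using rho b
    by (intro summable_sums summable_rabs_cancel[OF summable_ml_series[OF rho _ Suc_neg_power_bound]]) auto
  from sums_minus[OF this]
  have "(\<Sum>n. real (Suc n) * ((- 1) ^ Suc n / Gamma (\<rho> * Suc n + b)) * x ^ n) =
    - ml_series \<rho> (b + \<rho>) (\<lambda>n. real (Suc n) * (- 1) ^ n) x"
    by (simp add: sums_iff algebra_simps)
  with ml_series_deriv[OF rho b neg_one_power_bound, of x] show ?thesis by (simp only:)
qed

text \<open>The factor n + 1 from differentiation cancels against Gamma(w + 1) = w Gamma(w) at w =
  \<rho> (n + 1), up to 1 / \<rho>.\<close>

lemma mlneg_1_deriv:
  assumes rho: "0 < \<rho>" "\<rho> < 1"
  shows "(mlneg \<rho> 1 has_field_derivative - mlneg \<rho> \<rho> x / \<rho>) (at x)"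
proof -
  have "real (Suc n) * ((- 1) ^ Suc n / Gamma (\<rho> * Suc n + 1)) * x ^ n
      = (- 1 / \<rho>) * ((- 1) ^ n / Gamma (\<rho> * n + \<rho>) * x ^ n)" for n
  proof -
    have z: "\<rho> * real n + \<rho> > 0" using rho by (intro add_nonneg_pos) auto
    have "Gamma (\<rho> * n + \<rho> + 1) = (\<rho> * n + \<rho>) * Gamma (\<rho> * n + \<rho>)"
      using z by (intro Gamma_plus1) (auto elim!: nonpos_Ints_cases)
    moreover have "\<rho> * real (Suc n) + 1 = \<rho> * n + \<rho> + 1" by (simp add: algebra_simps)
    moreover have "\<rho> * real n + \<rho> = \<rho> * real (Suc n)" by (simp add: algebra_simps)
    ultimately show ?thesis using rho Gamma_real_pos[OF z] by (simp add: divide_simps)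
  qed
  moreover have "(\<lambda>n. (- 1 / \<rho>) * ((- 1) ^ n / Gamma (\<rho> * n + \<rho>) * x ^ n)) sums ((- 1 / \<rho>) * mlneg \<rho> \<rho> x)"
    unfolding ml_series_def using rho
    by (intro sums_mult summable_sums summable_rabs_cancel[OF summable_ml_series[OF rho _ neg_one_power_bound]]) auto
  ultimately have "(\<Sum>n. real (Suc n) * ((- 1) ^ Suc n / Gamma (\<rho> * Suc n + 1)) * x ^ n) = - mlneg \<rho> \<rho> x / \<rho>"
    by (simp add: sums_iff)
  with ml_series_deriv[OF rho zero_less_one neg_one_power_bound, of x] show ?thesis by simp
qed

lemma ml_fun_pos_near_0:
  fixes \<rho> b R :: real
  assumes rho: "0 < \<rho>" "\<rho> < 1" and b: "b > 0" and c: "\<And>n. \<bar>c n\<bar> \<le> R ^ n" and c0: "c 0 > 0"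
  obtains d where "d > 0" "\<And>t. 0 < t \<Longrightarrow> t < d \<Longrightarrow> ml_fun \<rho> b c t > 0"
proof -
  have "isCont (ml_series \<rho> b c) 0"
    using continuous_on_ml_series[OF rho b c, of UNIV] by (simp add: continuous_on_eq_continuous_at)
  then have "(ml_series \<rho> b c \<longlongrightarrow> c 0 / Gamma b) (at 0)"
    by (simp add: isCont_def ml_series_0)
  moreover have "c 0 / Gamma b > 0" using c0 Gamma_real_pos[OF b] by simp
  ultimately have "\<forall>\<^sub>F x in at 0. ml_series \<rho> b c x > 0" by (rule order_tendstoD(1))
  then obtain e where e: "e > 0" "\<And>x. x \<noteq> 0 \<Longrightarrow> \<bar>x\<bar> < e \<Longrightarrow> ml_series \<rho> b c x > 0"
    by (auto simp: eventually_at dist_real_def)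
  show thesis
  proof
    show "e powr (1 / \<rho>) > 0" using e by simp
    fix t assume t: "0 < t" "t < e powr (1 / \<rho>)"
    then have "t powr \<rho> < (e powr (1 / \<rho>)) powr \<rho>" using rho by (intro powr_less_mono2) auto
    also have "\<dots> = e" using rho e by (simp add: powr_powr)
    finally show "ml_fun \<rho> b c t > 0"
      using t e(2)[of "t powr \<rho>"] by (simp add: ml_fun_def)
  qed
qed

text \<open>Here \<open>g\<close> is the kernel itself, so the monotonicity condition of
  \<open>volterra_positive\<close> is trivial. The choice t = x^(1/\<rho>) makes e(t) a positive
  multiple of E_{\<rho>,\<rho>}(-x).\<close>

lemma mlneg_pos:
  assumes rho: "0 < \<rho>" "\<rho> < 1" and x: "x \<ge> 0"
  shows "mlneg \<rho> \<rho> x > 0"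
proof (cases "x = 0")
  case True
  then show ?thesis using Gamma_real_pos[OF rho(1)] by (simp add: ml_series_0)
next
  case False
  then have x: "x > 0" using x by simp
  define t where "t = x powr (1 / \<rho>)"
  have t: "t > 0" using x by (simp add: t_def)
  obtain d where d: "d > 0" "\<And>t. 0 < t \<Longrightarrow> t < d \<Longrightarrow> ml_fun \<rho> \<rho> (\<lambda>n. (- 1) ^ n) t > 0"
    using ml_fun_pos_near_0[OF rho rho(1) neg_one_power_bound] by auto
  have "ml_fun \<rho> \<rho> (\<lambda>n. (- 1) ^ n) t > 0"
  proof (rule volterra_positive[OF rho _ d, where g = "rl_kernel \<rho>"])
    show "continuous_on {0<..} (ml_fun \<rho> \<rho> (\<lambda>n. (- 1) ^ n))"
      by (rule continuous_on_ml_fun[OF rho rho(1) neg_one_power_bound])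
    fix r :: real assume r: "r > 0"
    show "rl_integrable \<rho> (ml_fun \<rho> \<rho> (\<lambda>n. (- 1) ^ n)) r"
      by (rule rl_int_ml_fun(1)[OF rho rho(1) rho(1) neg_one_power_bound r])
    show "ml_fun \<rho> \<rho> (\<lambda>n. (- 1) ^ n) r + rl_int \<rho> (ml_fun \<rho> \<rho> (\<lambda>n. (- 1) ^ n)) r = rl_kernel \<rho> r"
      unfolding rl_int_ml_fun(2)[OF rho rho(1) rho(1) neg_one_power_bound r]
      by (rule ml_fun_resolvent[OF rho rho(1) r])
  qed (use t in auto)
  moreover have "t powr \<rho> = x" using rho x by (simp add: t_def powr_powr)
  ultimately show ?thesis using t by (simp add: ml_fun_def zero_less_mult_iff)
qed

text \<open>With this series in place of E_{\<rho>,\<rho>}, the two resolvent identities give y + k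
  * y = k - e, to which the comparison argument applies a second time.\<close>

lemma mlneg_deriv_series_pos:
  assumes rho: "0 < \<rho>" "\<rho> < 1" and x: "x > 0"
  shows "ml_series \<rho> (\<rho> + \<rho>) (\<lambda>n. real (Suc n) * (- 1) ^ n) x > 0"
proof -
  define c where "c = (\<lambda>n. real (Suc n) * (- 1) ^ n :: real)"
  have cb: "\<bar>c n\<bar> \<le> 2 ^ n" for n unfolding c_def by (rule Suc_neg_power_bound)
  define y where "y = ml_fun \<rho> (\<rho> + \<rho>) c"
  define e where "e = ml_fun \<rho> \<rho> (\<lambda>n. (- 1) ^ n)"
  have rr: "\<rho> + \<rho> > 0" using rho by simp
  define t where "t = x powr (1 / \<rho>)"
  have t: "t > 0" using x by (simp add: t_def)
  obtain d where d: "d > 0" "\<And>t. 0 < t \<Longrightarrow> t < d \<Longrightarrow> y t > 0"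
    using ml_fun_pos_near_0[OF rho rr cb] unfolding y_def by (auto simp: c_def)
  have "y t > 0"
  proof (rule volterra_positive[OF rho _ d, where g = "\<lambda>t. rl_kernel \<rho> t - e t"])
    show "continuous_on {0<..} y"
      unfolding y_def by (rule continuous_on_ml_fun[OF rho rr cb])
    fix r :: real assume r: "r > 0"
    show "rl_integrable \<rho> y r"
      unfolding y_def by (rule rl_int_ml_fun(1)[OF rho rho(1) rr cb r])
    have "rl_int \<rho> y r = ml_fun \<rho> (\<rho> + \<rho> + \<rho>) c r"
      unfolding y_def using rl_int_ml_fun(2)[OF rho rho(1) rr cb r] by (simp add: add_ac)
    then show "y r + rl_int \<rho> y r = rl_kernel \<rho> r - e r"
      using ml_fun_resolvent_deriv[OF rho rr r] ml_fun_resolvent[OF rho rho(1) r]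
      by (simp add: y_def e_def c_def)
  next
    \<comment> \<open>The quotient g / k is 1 - Gamma(\<rho>) E_{\<rho>,\<rho>}(-t^\<rho>), so it
      increases only if E decreases, which is what is to be shown. The circle is broken because
      monotonicity is demanded only up to a point before which \<open>y\<close>, a positive multiple
      of minus the derivative of E, is known to be positive.\<close>
    fix s r assume sr: "0 < s" "s \<le> r" and pos: "\<And>q. 0 < q \<Longrightarrow> q < r \<Longrightarrow> y q > 0"
    have "mlneg \<rho> \<rho> (r powr \<rho>) \<le> mlneg \<rho> \<rho> (s powr \<rho>)"
    proof (rule DERIV_nonpos_imp_decreasing_open[where f = "mlneg \<rho> \<rho>"])
      show "s powr \<rho> \<le> r powr \<rho>" using sr rho by (intro powr_mono2) auto
      show "continuous_on {s powr \<rho>..r powr \<rho>} (mlneg \<rho> \<rho>)"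
        by (rule continuous_on_ml_series[OF rho rho(1) neg_one_power_bound])
      fix u assume u: "s powr \<rho> < u" "u < r powr \<rho>"
      have u0: "u > 0" using u(1) by (rule le_less_trans[OF powr_ge_zero])
      define q where "q = u powr (1 / \<rho>)"
      have q: "q powr \<rho> = u" "q > 0" using u0 rho by (auto simp: q_def powr_powr)
      have "q < r" using u(2) sr q rho
        by (metis leD le_less_linear less_imp_le powr_mono2 order.strict_trans2)
      then have "y q > 0" using pos q by simp
      then have "ml_series \<rho> (\<rho> + \<rho>) c u > 0"
        using q by (simp add: y_def ml_fun_def zero_less_mult_iff)
      then show "\<exists>z. (mlneg \<rho> \<rho> has_real_derivative z) (at u) \<and> z \<le> 0"
        using mlneg_deriv[OF rho rho(1), of u] by (auto simp: c_def intro!: exI)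
    qed
    then have "mlneg \<rho> \<rho> (r powr \<rho>) * (r powr (\<rho> - 1) * rl_kernel \<rho> s)
        \<le> mlneg \<rho> \<rho> (s powr \<rho>) * (r powr (\<rho> - 1) * rl_kernel \<rho> s)"
      using rl_kernel_nonneg[OF rho(1)] by (intro mult_right_mono) auto
    then have "e r * rl_kernel \<rho> s \<le> e s * rl_kernel \<rho> r"
      by (simp add: e_def ml_fun_def rl_kernel_def mult_ac)
    then show "(rl_kernel \<rho> s - e s) * rl_kernel \<rho> r \<le> (rl_kernel \<rho> r - e r) * rl_kernel \<rho> s"
      by (simp add: algebra_simps)
  qed (use t in auto)
  moreover have "t powr \<rho> = x" using rho x by (simp add: t_def powr_powr)
  ultimately show ?thesis using t by (simp add: y_def ml_fun_def c_def zero_less_mult_iff)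
qed

lemma mlneg_antimono:
  assumes rho: "0 < \<rho>" "\<rho> < 1" and xy: "0 \<le> x" "x \<le> y"
  shows "mlneg \<rho> \<rho> y \<le> mlneg \<rho> \<rho> x"
proof (rule DERIV_nonpos_imp_decreasing_open[OF xy(2), where f = "mlneg \<rho> \<rho>"])
  show "continuous_on {x..y} (mlneg \<rho> \<rho>)"
    by (rule continuous_on_ml_series[OF rho rho(1) neg_one_power_bound])
  fix u assume "x < u" "u < y"
  then have "ml_series \<rho> (\<rho> + \<rho>) (\<lambda>n. real (Suc n) * (- 1) ^ n) u > 0"
    using xy by (intro mlneg_deriv_series_pos[OF rho]) auto
  then show "\<exists>z. (mlneg \<rho> \<rho> has_real_derivative z) (at u) \<and> z \<le> 0"
    using mlneg_deriv[OF rho rho(1), of u] by (intro exI conjI) auto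
qed

section \<open>Two-sided decay estimates\<close>

lemma mlneg_le:
  assumes rho: "0 < \<rho>" "\<rho> < 1" and x: "0 \<le> x"
  shows "mlneg \<rho> \<rho> x \<le> 1 / Gamma \<rho>"
  using mlneg_antimono[OF rho order_refl x] by (simp add: ml_series_0)

text \<open>Mean value theorem, with the intermediate derivative replaced by its values at the end
  points by monotonicity.\<close>

lemma mlneg_1_diff:
  assumes rho: "0 < \<rho>" "\<rho> < 1" and xy: "0 \<le> x" "x < y"
  shows "(y - x) * mlneg \<rho> \<rho> y / \<rho> \<le> mlneg \<rho> 1 x - mlneg \<rho> 1 y"
    and "mlneg \<rho> 1 x - mlneg \<rho> 1 y \<le> (y - x) * mlneg \<rho> \<rho> x / \<rho>"
proof -
  obtain u where u: "x < u" "u < y" "mlneg \<rho> 1 y - mlneg \<rho> 1 x = (y - x) * (- mlneg \<rho> \<rho> u / \<rho>)"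
    using MVT2[OF xy(2), of "mlneg \<rho> 1" "\<lambda>u. - mlneg \<rho> \<rho> u / \<rho>"] mlneg_1_deriv[OF rho] by auto
  have *: "mlneg \<rho> 1 x - mlneg \<rho> 1 y = (y - x) * mlneg \<rho> \<rho> u / \<rho>"
    using u(3) by (simp add: algebra_simps)
  show "(y - x) * mlneg \<rho> \<rho> y / \<rho> \<le> mlneg \<rho> 1 x - mlneg \<rho> 1 y"
    unfolding * using rho u xy by (intro divide_right_mono mult_left_mono mlneg_antimono) auto
  show "mlneg \<rho> 1 x - mlneg \<rho> 1 y \<le> (y - x) * mlneg \<rho> \<rho> x / \<rho>"
    unfolding * using rho u xy by (intro divide_right_mono mult_left_mono mlneg_antimono) auto
qed

lemma mlneg_1_antimono:
  assumes rho: "0 < \<rho>" "\<rho> < 1" and xy: "0 \<le> x" "x \<le> y"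
  shows "mlneg \<rho> 1 y \<le> mlneg \<rho> 1 x"
proof (cases "x = y")
  case False
  then have "0 \<le> (y - x) * mlneg \<rho> \<rho> y / \<rho>"
    using mlneg_pos[OF rho, of y] rho xy by (intro divide_nonneg_pos mult_nonneg_nonneg) auto
  also have "\<dots> \<le> mlneg \<rho> 1 x - mlneg \<rho> 1 y"
    using False xy by (intro mlneg_1_diff[OF rho]) auto
  finally show ?thesis by simp
qed auto

lemma mlneg_1_le_1:
  assumes rho: "0 < \<rho>" "\<rho> < 1" and x: "0 \<le> x"
  shows "mlneg \<rho> 1 x \<le> 1"
  using mlneg_1_antimono[OF rho order_refl x] by (simp add: ml_series_0)

lemma ml_fun_powr_root:
  assumes "0 < \<rho>" "x > 0"
  shows "ml_fun \<rho> b c (x powr (1 / \<rho>)) = x powr ((b - 1) / \<rho>) * ml_series \<rho> b c x"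
  using assms by (simp add: ml_fun_def powr_powr)

text \<open>z is the fractional integral of order 1 - \<rho> of the positive function e.\<close>

lemma mlneg_1_ge_0:
  assumes rho: "0 < \<rho>" "\<rho> < 1" and x: "0 \<le> x"
  shows "mlneg \<rho> 1 x \<ge> 0"
proof (cases "x = 0")
  case False
  with x have x: "x > 0" by simp
  let ?t = "x powr (1 / \<rho>)"
  have t: "?t > 0" using x by simp
  have r1: "1 - \<rho> > 0" using rho by simp
  have "0 \<le> rl_int (1 - \<rho>) (ml_fun \<rho> \<rho> (\<lambda>n. (- 1) ^ n)) ?t"
    unfolding rl_int_def set_lebesgue_integral_def
    using rl_kernel_nonneg[OF r1] mlneg_pos[OF rho]
    by (intro Bochner_Integration.integral_nonneg) (auto simp: indicator_def ml_fun_def less_imp_le)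
  then show ?thesis
    using x rl_int_ml_fun(2)[OF rho r1 rho(1) neg_one_power_bound t]
    by (simp add: ml_fun_powr_root[OF rho(1) x])
qed (simp add: ml_series_0)

text \<open>In z + k * z = 1 the decreasing function z is replaced under the integral by its final
  value, which gives z(x) x / Gamma(1 + \<rho>) \<le> 1.\<close>

lemma mlneg_1_upper:
  assumes rho: "0 < \<rho>" "\<rho> < 1" and x: "0 < x"
  shows "x * mlneg \<rho> 1 x \<le> Gamma (1 + \<rho>)"
proof -
  define t where "t = x powr (1 / \<rho>)"
  have t: "t > 0" using x by (simp add: t_def)
  have tx: "t powr \<rho> = x" using rho x by (simp add: t_def powr_powr)
  let ?z = "ml_fun \<rho> 1 (\<lambda>n. (- 1) ^ n)"
  have z: "?z s = mlneg \<rho> 1 (s powr \<rho>)" if "s > 0" for s using that by (simp add: ml_fun_def)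
  have int: "set_integrable lborel {0<..<t} (\<lambda>s. rl_kernel \<rho> (t - s) * ?z s)"
    using rl_int_ml_fun(1)[OF rho rho(1) zero_less_one neg_one_power_bound t] by (simp add: rl_integrable_def)
  have int1: "set_integrable lborel {0<..<t} (\<lambda>s. rl_kernel \<rho> (t - s) * rl_kernel 1 s)"
    using rl_kernel_conv(1)[OF rho(1) zero_less_one t] by (simp add: rl_integrable_def)
  have "mlneg \<rho> 1 x * rl_kernel (\<rho> + 1) t = (LBINT s:{0<..<t}. mlneg \<rho> 1 x * (rl_kernel \<rho> (t - s) * rl_kernel 1 s))"
    using rl_kernel_conv(2)[OF rho(1) zero_less_one t] by (simp add: rl_int_def)
  also have "\<dots> \<le> (LBINT s:{0<..<t}. rl_kernel \<rho> (t - s) * ?z s)"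
  proof (rule set_integral_mono[OF set_integrable_mult_right[OF int1] int])
    fix s assume s: "s \<in> {0<..<t}"
    have "mlneg \<rho> 1 x \<le> ?z s"
      using s rho by (subst z) (auto simp flip: tx intro!: mlneg_1_antimono[OF rho] powr_mono2)
    then have "mlneg \<rho> 1 x * rl_kernel \<rho> (t - s) \<le> ?z s * rl_kernel \<rho> (t - s)"
      using rl_kernel_nonneg[OF rho(1)] by (intro mult_right_mono) auto
    then show "mlneg \<rho> 1 x * (rl_kernel \<rho> (t - s) * rl_kernel 1 s) \<le> rl_kernel \<rho> (t - s) * ?z s"
      using s by (simp add: rl_kernel_1 mult.commute)
  qed
  also have "\<dots> = ml_fun \<rho> (\<rho> + 1) (\<lambda>n. (- 1) ^ n) t"
    using rl_int_ml_fun(2)[OF rho rho(1) zero_less_one neg_one_power_bound t] by (simp add: rl_int_def)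
  also have "\<dots> = 1 - ?z t"
    using ml_fun_resolvent[OF rho zero_less_one t] t by (simp add: rl_kernel_1 add.commute)
  also have "\<dots> \<le> 1" using z[OF t] mlneg_1_ge_0[OF rho, of x] x tx by simp
  finally have "mlneg \<rho> 1 x * rl_kernel (\<rho> + 1) t \<le> 1" .
  moreover have "Gamma (1 + \<rho>) > 0" using rho by (intro Gamma_real_pos) auto
  ultimately show ?thesis using tx by (simp add: rl_kernel_def add.commute divide_simps mult.commute)
qed

text \<open>The integral of e over (0, t) is 1 - z, while z is the convolution of e with the kernel
  of order 1 - \<rho>. That kernel decreases, so it may be replaced by its value 1 / (Gamma(1 -
  \<rho>) x) at the far end.\<close>

lemma mlneg_1_lower:
  assumes rho: "0 < \<rho>" "\<rho> < 1" and x: "0 < x"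
  shows "1 - mlneg \<rho> 1 x \<le> Gamma (1 - \<rho>) * (x * mlneg \<rho> 1 x)"
proof -
  define t where "t = x powr (1 / \<rho>)"
  have t: "t > 0" using x by (simp add: t_def)
  have tx: "t powr \<rho> = x" using rho x by (simp add: t_def powr_powr)
  have r1: "1 - \<rho> > 0" using rho by simp
  have G: "Gamma (1 - \<rho>) > 0" using r1 by (rule Gamma_real_pos)
  let ?e = "ml_fun \<rho> \<rho> (\<lambda>n. (- 1) ^ n)"
  let ?z = "ml_fun \<rho> 1 (\<lambda>n. (- 1) ^ n)"
  have epos: "?e s > 0" if "s > 0" for s
    using mlneg_pos[OF rho, of "s powr \<rho>"] that by (simp add: ml_fun_def)
  have zt: "?z t = mlneg \<rho> 1 x" using t tx by (simp add: ml_fun_def)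
  have int1: "set_integrable lborel {0<..<t} (\<lambda>s. rl_kernel 1 (t - s) * ?e s)"
    using rl_int_ml_fun(1)[OF rho zero_less_one rho(1) neg_one_power_bound t] by (simp add: rl_integrable_def)
  have int2: "set_integrable lborel {0<..<t} (\<lambda>s. rl_kernel (1 - \<rho>) (t - s) * ?e s)"
    using rl_int_ml_fun(1)[OF rho r1 rho(1) neg_one_power_bound t] by (simp add: rl_integrable_def)
  have "rl_kernel (1 - \<rho>) t * (1 - mlneg \<rho> 1 x) = rl_kernel (1 - \<rho>) t * rl_int 1 ?e t"
    using rl_int_ml_fun(2)[OF rho zero_less_one rho(1) neg_one_power_bound t]
      ml_fun_resolvent[OF rho zero_less_one t] t zt by (simp add: rl_kernel_1)
  also have "\<dots> = (LBINT s:{0<..<t}. rl_kernel (1 - \<rho>) t * (rl_kernel 1 (t - s) * ?e s))"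
    by (simp add: rl_int_def)
  also have "\<dots> \<le> (LBINT s:{0<..<t}. rl_kernel (1 - \<rho>) (t - s) * ?e s)"
  proof (rule set_integral_mono[OF set_integrable_mult_right[OF int1] int2])
    fix s assume s: "s \<in> {0<..<t}"
    have "rl_kernel (1 - \<rho>) t \<le> rl_kernel (1 - \<rho>) (t - s)"
      using s rho G by (auto simp: rl_kernel_def intro!: divide_right_mono powr_mono2')
    then have "rl_kernel (1 - \<rho>) t * ?e s \<le> rl_kernel (1 - \<rho>) (t - s) * ?e s"
      using epos[of s] s by (intro mult_right_mono) auto
    then show "rl_kernel (1 - \<rho>) t * (rl_kernel 1 (t - s) * ?e s) \<le> rl_kernel (1 - \<rho>) (t - s) * ?e s"
      using s by (simp add: rl_kernel_1)
  qed
  also have "\<dots> = mlneg \<rho> 1 x"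
    using rl_int_ml_fun(2)[OF rho r1 rho(1) neg_one_power_bound t] zt by (simp add: rl_int_def)
  finally have "rl_kernel (1 - \<rho>) t * (1 - mlneg \<rho> 1 x) \<le> mlneg \<rho> 1 x" .
  moreover have "rl_kernel (1 - \<rho>) t = 1 / (Gamma (1 - \<rho>) * x)"
    using t tx by (simp add: rl_kernel_def powr_minus divide_simps)
  ultimately show ?thesis using G x by (simp add: divide_simps mult_ac)
qed

text \<open>The drop of z from x/2 to x is at least (x/2) E_{\<rho>,\<rho>}(-x) / \<rho>, and z(x/2)
  is of order 1/x.\<close>

lemma mlneg_decay_upper:
  assumes rho: "0 < \<rho>" "\<rho> < 1" and x: "0 \<le> x"
  shows "x\<^sup>2 * mlneg \<rho> \<rho> x \<le> 4 * \<rho> * Gamma (1 + \<rho>)"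
proof (cases "x = 0")
  case True
  then show ?thesis using rho Gamma_real_pos[of "1 + \<rho>"] by simp
next
  case False
  with x have x: "x > 0" by simp
  have "(x - x / 2) * mlneg \<rho> \<rho> x / \<rho> \<le> mlneg \<rho> 1 (x / 2) - mlneg \<rho> 1 x"
    using x by (intro mlneg_1_diff[OF rho]) auto
  also have "\<dots> \<le> mlneg \<rho> 1 (x / 2)" using mlneg_1_ge_0[OF rho, of x] x by simp
  finally have "x * mlneg \<rho> \<rho> x \<le> 2 * \<rho> * mlneg \<rho> 1 (x / 2)"
    using rho by (simp add: field_simps)
  then have "x * (x * mlneg \<rho> \<rho> x) \<le> x * (2 * \<rho> * mlneg \<rho> 1 (x / 2))"
    using x by (intro mult_left_mono) auto
  also have "\<dots> = 4 * \<rho> * (x / 2 * mlneg \<rho> 1 (x / 2))" by simp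
  also have "\<dots> \<le> 4 * \<rho> * Gamma (1 + \<rho>)"
    using rho x by (intro mult_left_mono mlneg_1_upper[OF rho]) auto
  finally show ?thesis by (simp add: power2_eq_square mult.assoc)
qed

lemma mlneg_decay_lower:
  assumes rho: "0 < \<rho>" "\<rho> < 1" and x0: "0 < x0"
  obtains c where "c > 0" "\<And>x. x \<ge> x0 \<Longrightarrow> c \<le> x\<^sup>2 * mlneg \<rho> \<rho> x"
proof -
  let ?E = "mlneg \<rho> \<rho>" and ?Z = "mlneg \<rho> 1"
  define G where "G = Gamma (1 + \<rho>)"
  \<comment> \<open>Beyond \<open>x1 = 2 * G\<close> the upper bound gives z \<le> 1/2, so
    \<open>mlneg_1_lower\<close> yields x z(x) \<ge> \<open>c0\<close>.\<close>
  define c0 where "c0 = 1 / (2 * Gamma (1 - \<rho>))"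
  \<comment> \<open>Chosen so that x z(M x) \<le> G / M = c0 / 2: half of x z(x) \<ge> c0 survives
    in the difference.\<close>
  define M where "M = 2 * G / c0"
  define x1 where "x1 = 2 * G"
  have G: "G > 0" unfolding G_def using rho by (intro Gamma_real_pos) auto
  have Gm: "Gamma (1 - \<rho>) > 0" using rho by (intro Gamma_real_pos) auto
  have c0: "c0 > 0" using Gm by (simp add: c0_def)
  have x1: "x1 > 0" using G by (simp add: x1_def)
  have Zlow: "c0 \<le> x * ?Z x" if "x \<ge> x1" for x
  proof -
    have x: "x > 0" using that x1 by simp
    have "x1 * ?Z x \<le> x * ?Z x" using that mlneg_1_ge_0[OF rho, of x] x by (intro mult_right_mono) auto
    also have "\<dots> \<le> G" unfolding G_def by (rule mlneg_1_upper[OF rho x])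
    finally have "?Z x \<le> 1 / 2" using G by (simp add: x1_def field_simps)
    then have "1 / 2 \<le> Gamma (1 - \<rho>) * (x * ?Z x)" using mlneg_1_lower[OF rho x] by simp
    then show ?thesis using Gm by (simp add: c0_def field_simps)
  qed
  have "c0 \<le> G" using Zlow[of x1] mlneg_1_upper[OF rho x1] unfolding G_def by simp
  then have M: "M \<ge> 2" using c0 G by (simp add: M_def field_simps)
  define c1 where "c1 = \<rho> * c0 / (2 * (M - 1))"
  have c1: "c1 > 0" using rho c0 M by (simp add: c1_def)
  have far: "c1 \<le> x\<^sup>2 * ?E x" if "x \<ge> x1" for x
  proof -
    have x: "x > 0" using that x1 by simp
    have "x < M * x" using M x by simp
    then have "?Z x - ?Z (M * x) \<le> (M * x - x) * ?E x / \<rho>"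
      using x by (intro mlneg_1_diff(2)[OF rho]) auto
    then have "x * (?Z x - ?Z (M * x)) \<le> x * ((M * x - x) * ?E x / \<rho>)"
      using x by (intro mult_left_mono) auto
    moreover have "x * ?Z (M * x) \<le> c0 / 2"
    proof -
      have "M * x * ?Z (M * x) \<le> G" unfolding G_def using M x by (intro mlneg_1_upper[OF rho]) auto
      then show ?thesis using M c0 G by (simp add: M_def field_simps)
    qed
    moreover have "x * (?Z x - ?Z (M * x)) = x * ?Z x - x * ?Z (M * x)" by (rule right_diff_distrib)
    ultimately have "c0 / 2 \<le> x * ((M * x - x) * ?E x / \<rho>)"
      using Zlow[OF that] by linarith
    also have "\<dots> = (M - 1) * (x\<^sup>2 * ?E x) / \<rho>" by (simp add: power2_eq_square algebra_simps)
    finally show ?thesis using M rho by (simp add: c1_def field_simps)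
  qed
  \<comment> \<open>Between \<open>x0\<close> and \<open>x1\<close> monotonicity bounds E from below
    by its value at \<open>x1\<close>. A positive \<open>x0\<close> is essential, as x^2
    E_{\<rho>,\<rho>}(-x) vanishes at 0.\<close>
  define c where "c = min c1 (x0\<^sup>2 * (c1 / x1\<^sup>2))"
  show thesis
  proof
    show "c > 0" using c1 x0 x1 by (simp add: c_def)
    fix x assume x: "x \<ge> x0"
    show "c \<le> x\<^sup>2 * ?E x"
    proof (cases "x \<ge> x1")
      case True
      then show ?thesis using far[OF True] by (simp add: c_def)
    next
      case False
      have "c1 / x1\<^sup>2 \<le> ?E x1" using far[of x1] x1 by (simp add: field_simps)
      also have "\<dots> \<le> ?E x" using False x x0 by (intro mlneg_antimono[OF rho]) auto
      finally have "x0\<^sup>2 * (c1 / x1\<^sup>2) \<le> x\<^sup>2 * ?E x"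
        using x x0 c1 by (intro mult_mono power_mono) auto
      then show ?thesis by (simp add: c_def)
    qed
  qed
qed

section \<open>Uniqueness for scalar equations\<close>

text \<open>Fubini. The inner integral of the product of the two nonnegative kernels is the kernel
  of order a + b, so integrability of \<open>f\<close> against that kernel is all that absolute
  integrability on the product space asks for.\<close>

lemma rl_int_rl_int:
  assumes a: "0 < a" and b: "0 < b"
    and meas: "set_borel_measurable borel {0<..<t} f"
    and int: "rl_integrable (a + b) f t"
  shows "rl_int a (rl_int b f) t = rl_int (a + b) f t"
proof -
  define H where "H x = indicator {0<..<t} x * f x" for x
  have [measurable]: "H \<in> borel_measurable borel"
    using meas by (simp add: set_borel_measurable_def H_def[abs_def])
  define G where "G x s = (if x < s \<and> s < t then rl_kernel a (t - s) * rl_kernel b (s - x) else 0)" for x s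
  have G_meas [measurable]: "(\<lambda>(x, s). G x s) \<in> borel_measurable (borel \<Otimes>\<^sub>M borel)"
    unfolding G_def by measurable
  have G_ind: "G x s = indicator {x<..<t} s * (rl_kernel a (t - s) * rl_kernel b (s - x))" for x s
    by (simp add: G_def indicator_def)
  have G0: "G x s \<ge> 0" for x s
    using rl_kernel_nonneg[OF a] rl_kernel_nonneg[OF b] by (simp add: G_def)
  have Gint: "integrable lborel (G x)" "(\<integral>s. G x s \<partial>lborel) = rl_kernel (a + b) (t - x)" if "x < t" for x
    using rl_kernel_conv_shift[OF a b that] by (simp_all add: G_ind[abs_def])
  have int': "integrable lborel (\<lambda>x. rl_kernel (a + b) (t - x) * H x)"
    using int by (simp add: rl_integrable_def set_integrable_def H_def mult_ac)
  have prod: "integrable (lborel \<Otimes>\<^sub>M lborel) (\<lambda>(x, s). H x * G x s)"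
  proof (rule lborel_pair.Fubini_integrable)
    show "(\<lambda>(x, s). H x * G x s) \<in> borel_measurable (lborel \<Otimes>\<^sub>M lborel)"
      by measurable
    have "(\<integral>s. norm (H x * G x s) \<partial>lborel) = \<bar>rl_kernel (a + b) (t - x) * H x\<bar>" for x
    proof (cases "x < t")
      case True
      then show ?thesis using Gint[OF True] G0 rl_kernel_nonneg[of "a + b"] a b by (simp add: abs_mult)
    qed (auto simp: H_def)
    then show "integrable lborel (\<lambda>x. \<integral>s. norm (case (x, s) of (x, s) \<Rightarrow> H x * G x s) \<partial>lborel)"
      using integrable_abs[OF int'] by simp
    show "AE x in lborel. integrable lborel (\<lambda>s. case (x, s) of (x, s) \<Rightarrow> H x * G x s)"
    proof (rule AE_I2)
      fix x show "integrable lborel (\<lambda>s. case (x, s) of (x, s) \<Rightarrow> H x * G x s)"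
        using Gint(1)[of x] by (cases "x < t") (auto simp: H_def)
    qed
  qed
  have "(\<integral>s. (\<integral>x. H x * G x s \<partial>lborel) \<partial>lborel) = (\<integral>x. (\<integral>s. H x * G x s \<partial>lborel) \<partial>lborel)"
    by (rule lborel_pair.Fubini_integral[OF prod])
  also have "(\<lambda>x. \<integral>s. H x * G x s \<partial>lborel) = (\<lambda>x. rl_kernel (a + b) (t - x) * H x)"
  proof
    fix x show "(\<integral>s. H x * G x s \<partial>lborel) = rl_kernel (a + b) (t - x) * H x"
      using Gint(2)[of x] by (cases "x < t") (auto simp: H_def)
  qed
  also have "(\<integral>x. rl_kernel (a + b) (t - x) * H x \<partial>lborel) = rl_int (a + b) f t"
    by (simp add: rl_int_def set_lebesgue_integral_def H_def mult_ac)
  also have "(\<lambda>s. \<integral>x. H x * G x s \<partial>lborel) = (\<lambda>s. indicator {0<..<t} s * (rl_kernel a (t - s) * rl_int b f s))"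
  proof
    fix s
    have "H x * G x s = (indicator {0<..<t} s * rl_kernel a (t - s)) * (indicator {0<..<s} x * (rl_kernel b (s - x) * f x))" for x
      by (auto simp: H_def G_def indicator_def)
    then show "(\<integral>x. H x * G x s \<partial>lborel) = indicator {0<..<t} s * (rl_kernel a (t - s) * rl_int b f s)"
      by (simp add: rl_int_def set_lebesgue_integral_def)
  qed
  finally show ?thesis by (simp add: rl_int_def[of a] set_lebesgue_integral_def)
qed

lemma rl_int_1: "rl_int 1 f t = (LBINT s:{0<..<t}. f s)"
  unfolding rl_int_def by (rule set_lebesgue_integral_cong) (auto simp: rl_kernel_1)

lemma rl_integrable_1: "rl_integrable 1 f t \<longleftrightarrow> set_integrable lborel {0<..<t} f"
  unfolding rl_integrable_def by (rule set_integrable_cong) (auto simp: rl_kernel_1)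

lemma LBINT_diff:
  fixes f :: "real \<Rightarrow> real"
  assumes su: "0 < s" "s \<le> u" and int: "set_integrable lborel {0<..<u} f"
  shows "(LBINT x:{0<..<u}. f x) - (LBINT x:{0<..<s}. f x) = integral {s..u} f"
proof (cases "s = u")
  case False
  with su have su: "0 < s" "s < u" by auto
  have i1: "set_integrable lborel {0<..<s} f"
    by (rule set_integrable_subset[OF int]) (use su in auto)
  have i2: "set_integrable lborel {s..<u} f"
    by (rule set_integrable_subset[OF int]) (use su in auto)
  have "{0<..<u} = {0<..<s} \<union> {s..<u}" using su by auto
  then have "(LBINT x:{0<..<u}. f x) = (LBINT x:{0<..<s}. f x) + (LBINT x:{s..<u}. f x)"
    by (simp only:) (rule set_integral_Un[OF _ i1 i2], auto)
  also have "(LBINT x:{s..<u}. f x) = integral {s..<u} f"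
    by (rule set_borel_integral_eq_integral(2)[OF i2])
  also have "integral {s..<u} f = integral {s..u} f"
    by (rule integral_subset_negligible) (auto intro!: negligible_subset[OF negligible_sing[of u]])
  finally show ?thesis by simp
qed simp

text \<open>The integrand may be singular at 0, so the fundamental theorem is applied on an interval
  [a, b] around t with a > 0, and the integral over (0, a) is a constant.\<close>

lemma LBINT_has_derivative:
  fixes f :: "real \<Rightarrow> real"
  assumes cont: "continuous_on {0<..<T} f" and int: "\<And>t. 0 < t \<Longrightarrow> t < T \<Longrightarrow> set_integrable lborel {0<..<t} f"
    and t: "0 < t" "t < T"
  shows "((\<lambda>t. LBINT x:{0<..<t}. f x) has_real_derivative f t) (at t)"
proof -
  define a where "a = t / 2"
  define b where "b = (t + T) / 2"
  have ab: "0 < a" "a < t" "t < b" "b < T" using t by (auto simp: a_def b_def)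
  have "continuous_on {a..b} f" using ab by (intro continuous_on_subset[OF cont]) auto
  then have "((\<lambda>u. integral {a..u} f) has_real_derivative f t) (at t within {a..b})"
    using ab by (intro integral_has_real_derivative) auto
  then have "((\<lambda>u. integral {a..u} f) has_real_derivative f t) (at t)"
    using ab by (simp add: at_within_Icc_at)
  then have "((\<lambda>u. (LBINT x:{0<..<a}. f x) + integral {a..u} f) has_real_derivative f t) (at t)"
    by (auto intro!: derivative_eq_intros)
  then show ?thesis
  proof (rule has_field_derivative_transform_within_open[of _ _ _ "{a<..<b}"])
    fix u assume u: "u \<in> {a<..<b}"
    show "(LBINT x:{0<..<a}. f x) + integral {a..u} f = (LBINT x:{0<..<u}. f x)"
      using LBINT_diff[of a u f] int[of u] u ab by auto
  qed (use ab in auto)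
qed

text \<open>Inserting the bound into the equation n times gives M |l|^n
  \<open>rl_kernel (\<rho> * n + 1) t\<close>, the terms of a convergent Mittag-Leffler series,
  which tend to 0.\<close>

lemma volterra_zero:
  fixes R :: "real \<Rightarrow> real"
  assumes rho: "0 < \<rho>" "\<rho> < 1"
    and bound: "\<And>t. 0 < t \<Longrightarrow> t < T \<Longrightarrow> \<bar>R t\<bar> \<le> M"
    and eq: "\<And>t. 0 < t \<Longrightarrow> t < T \<Longrightarrow> R t = l * rl_int \<rho> R t"
    and t: "0 < t" "t < T"
  shows "R t = 0"
proof -
  have M: "M \<ge> 0" using bound[OF t] by linarith
  have pos: "\<rho> * real n + 1 > 0" for n using rho by (simp add: add_nonneg_pos)
  have iter: "\<bar>R s\<bar> \<le> M * (\<bar>l\<bar> ^ n * rl_kernel (\<rho> * n + 1) s)" if "0 < s" "s < T" for n :: nat and s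
    using that
  proof (induction n arbitrary: s)
    case 0
    then show ?case using bound[of s] by (simp add: rl_kernel_1)
  next
    case (Suc n)
    let ?B = "\<lambda>x. M * \<bar>l\<bar> ^ n * (indicator {0<..<s} x * (rl_kernel \<rho> (s - x) * rl_kernel (\<rho> * n + 1) x))"
    note C = rl_kernel_conv[OF rho(1) pos[of n] Suc.prems(1), unfolded rl_integrable_def set_integrable_def
      rl_int_def set_lebesgue_integral_def real_scaleR_def]
    have "\<bar>rl_int \<rho> R s\<bar> \<le> (\<integral>x. norm (indicator {0<..<s} x * (rl_kernel \<rho> (s - x) * R x)) \<partial>lborel)"
      using integral_norm_bound[of lborel "\<lambda>x. indicator {0<..<s} x * (rl_kernel \<rho> (s - x) * R x)"]
      by (simp add: rl_int_def set_lebesgue_integral_def)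
    also have "\<dots> \<le> (\<integral>x. ?B x \<partial>lborel)"
    proof (rule integral_mono')
      show "integrable lborel ?B" by (intro integrable_mult_right C(1))
      fix x
      show "0 \<le> ?B x" using M rl_kernel_nonneg[OF rho(1)] rl_kernel_nonneg[OF pos] by simp
      show "norm (indicator {0<..<s} x * (rl_kernel \<rho> (s - x) * R x)) \<le> ?B x"
      proof (cases "x \<in> {0<..<s}")
        case True
        then have "rl_kernel \<rho> (s - x) * \<bar>R x\<bar> \<le> rl_kernel \<rho> (s - x) * (M * (\<bar>l\<bar> ^ n * rl_kernel (\<rho> * n + 1) x))"
          using Suc.IH[of x] Suc.prems rl_kernel_nonneg[OF rho(1)] by (intro mult_left_mono) auto
        then show ?thesis using True rl_kernel_nonneg[OF rho(1), of "s - x"] by (simp add: abs_mult mult_ac)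
      qed simp
    qed
    also have "\<dots> = M * \<bar>l\<bar> ^ n * rl_kernel (\<rho> + (\<rho> * n + 1)) s"
      by (subst integral_mult_right_zero, subst C(2)) simp
    also have "\<rho> + (\<rho> * n + 1) = \<rho> * Suc n + 1" by (simp add: algebra_simps)
    finally have "\<bar>l\<bar> * \<bar>rl_int \<rho> R s\<bar> \<le> \<bar>l\<bar> * (M * \<bar>l\<bar> ^ n * rl_kernel (\<rho> * Suc n + 1) s)"
      by (intro mult_left_mono) auto
    then show ?case using eq[OF Suc.prems] by (simp add: abs_mult mult_ac)
  qed
  have sm: "summable (\<lambda>n. \<bar>\<bar>l\<bar> ^ n * rl_kernel (\<rho> * n + 1) t\<bar>)"
    by (rule ml_fun_sums(2)[where c = "\<lambda>n. \<bar>l\<bar> ^ n" and R = "\<bar>l\<bar>", OF rho zero_less_one _ t(1)])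
      (rule eq_refl, rule abs_of_nonneg, simp)
  have "(\<lambda>n. \<bar>l\<bar> ^ n * rl_kernel (\<rho> * n + 1) t) \<longlonglongrightarrow> 0"
    by (rule summable_LIMSEQ_zero[OF summable_rabs_cancel[OF sm]])
  then have "(\<lambda>n. M * (\<bar>l\<bar> ^ n * rl_kernel (\<rho> * n + 1) t)) \<longlonglongrightarrow> 0"
    by (rule tendsto_mult_right_zero)
  then have "\<bar>R t\<bar> \<le> 0"
    by (rule LIMSEQ_le_const) (use iter[OF t] in auto)
  then show ?thesis by simp
qed

text \<open>For a \<le> 1 the reciprocal kernel Gamma(a) (t - s)^(1-a) is bounded on (0, t), so the
  weight can be divided out.\<close>

lemma rl_integrable_imp_set_integrable:
  assumes a: "0 < a" "a \<le> 1" and int: "rl_integrable a f t"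
  shows "set_integrable lborel {0<..<t} f"
proof (cases "t > 0")
  case True
  let ?F = "\<lambda>s. indicator {0<..<t} s * (rl_kernel a (t - s) * f s)"
  let ?g = "\<lambda>s. Gamma a * \<bar>t - s\<bar> powr (1 - a)"
  have G: "Gamma a > 0" using a(1) by (rule Gamma_real_pos)
  have F: "integrable lborel ?F" using int by (simp add: rl_integrable_def set_integrable_def)
  have eq: "indicator {0<..<t} s * f s = ?g s * ?F s" for s
    using G by (auto simp: indicator_def rl_kernel_def simp flip: powr_add)
  have "integrable lborel (\<lambda>s. indicator {0<..<t} s * f s)"
  proof (rule Bochner_Integration.integrable_bound)
    show "integrable lborel (\<lambda>s. Gamma a * t powr (1 - a) * ?F s)"
      by (intro integrable_mult_right F)
    have [measurable]: "?F \<in> borel_measurable borel" using F by simp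
    show "(\<lambda>s. indicator {0<..<t} s * f s) \<in> borel_measurable lborel"
      unfolding eq by measurable
    show "AE s in lborel. norm (indicator {0<..<t} s * f s) \<le> norm (Gamma a * t powr (1 - a) * ?F s)"
    proof (rule AE_I2)
      fix s show "norm (indicator {0<..<t} s * f s) \<le> norm (Gamma a * t powr (1 - a) * ?F s)"
      proof (cases "s \<in> {0<..<t}")
        case True
        then have "\<bar>t - s\<bar> powr (1 - a) \<le> t powr (1 - a)" using a by (intro powr_mono2) auto
        then have "\<bar>?g s\<bar> * \<bar>?F s\<bar> \<le> \<bar>Gamma a * t powr (1 - a)\<bar> * \<bar>?F s\<bar>"
          using G by (intro mult_right_mono) (auto simp: abs_mult)
        then show ?thesis unfolding eq real_norm_def abs_mult[of "?g s"] abs_mult[of "Gamma a * t powr (1 - a)"] .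
      qed simp
    qed
  qed
  then show ?thesis by (simp add: set_integrable_def)
qed (simp add: set_integrable_def)

text \<open>Integrating the equation to order \<rho> turns the left side into the primitive R of r,
  so R = - l k * R. The iteration works for R because a primitive is bounded near 0, where r is only
  integrable; then r = R' vanishes.\<close>

lemma rl_zero_solution:
  fixes r :: "real \<Rightarrow> real"
  assumes rho: "0 < \<rho>" "\<rho> < 1"
    and cont: "continuous_on {0<..<T} r"
    and int: "\<And>t. 0 < t \<Longrightarrow> t < T \<Longrightarrow> set_integrable lborel {0<..<t} r"
    and eq: "\<And>t. 0 < t \<Longrightarrow> t < T \<Longrightarrow> rl_int (1 - \<rho>) r t = - l * (LBINT s:{0<..<t}. r s)"
    and t: "0 < t" "t < T"
  shows "r t = 0"
proof -
  define R where "R = rl_int 1 r"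
  have R: "R s = (LBINT x:{0<..<s}. r x)" for s by (simp add: R_def rl_int_1)
  have RR: "R s = - l * rl_int \<rho> R s" if s: "0 < s" "s < T" for s
  proof -
    have "rl_int \<rho> (rl_int (1 - \<rho>) r) s = rl_int (\<rho> + (1 - \<rho>)) r s"
    proof (rule rl_int_rl_int)
      show "set_borel_measurable borel {0<..<s} r"
        using int[OF s] by (auto simp: set_integrable_def set_borel_measurable_def)
      show "rl_integrable (\<rho> + (1 - \<rho>)) r s"
        using int[OF s] by (simp add: rl_integrable_1)
    qed (use rho in auto)
    moreover have "rl_int \<rho> (rl_int (1 - \<rho>) r) s = (LBINT x:{0<..<s}. - l * (rl_kernel \<rho> (s - x) * R x))"
      unfolding rl_int_def[of \<rho>]
      using s by (intro set_lebesgue_integral_cong) (auto simp: eq R)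
    moreover have "\<dots> = - l * rl_int \<rho> R s"
      unfolding rl_int_def[of \<rho>] by (rule set_integral_mult_right)
    ultimately show ?thesis by (simp add: R_def)
  qed
  have R0: "R s = 0" if s: "0 < s" "s < T" for s
  proof -
    \<comment> \<open>Integrability of r is available on (0, t) only for t < T, so R is bounded on a
      slightly shorter interval containing s.\<close>
    define T' where "T' = (s + T) / 2"
    have T': "s < T'" "T' < T" using s by (auto simp: T'_def)
    show ?thesis
    proof (rule volterra_zero[OF rho, where R = R and T = T' and M = "LBINT x:{0<..<T'}. \<bar>r x\<bar>"])
      fix q assume q: "0 < q" "q < T'"
      have iT: "set_integrable lborel {0<..<T'} (\<lambda>x. \<bar>r x\<bar>)"
        using int[of T'] T' s by (intro set_integrable_abs) auto
      have "\<bar>R q\<bar> \<le> (\<integral>x. norm (indicator {0<..<q} x * r x) \<partial>lborel)"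
        using integral_norm_bound[of lborel "\<lambda>x. indicator {0<..<q} x * r x"]
        by (simp add: R set_lebesgue_integral_def)
      also have "\<dots> \<le> (\<integral>x. indicator {0<..<T'} x * \<bar>r x\<bar> \<partial>lborel)"
        using iT q by (intro integral_mono') (auto simp: set_integrable_def indicator_def)
      finally show "\<bar>R q\<bar> \<le> (LBINT x:{0<..<T'}. \<bar>r x\<bar>)"
        by (simp add: set_lebesgue_integral_def)
      show "R q = - l * rl_int \<rho> R q" using RR[of q] q T' by simp
    qed (use s T' in auto)
  qed
  have "(R has_real_derivative r t) (at t)"
    unfolding R[abs_def] by (rule LBINT_has_derivative[OF cont int t])
  moreover have "(R has_real_derivative 0) (at t)"
  proof (rule has_field_derivative_transform_within_open[where S = "{0<..<T}"])
    show "((\<lambda>_. 0) has_real_derivative 0) (at t)" by simp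
  qed (use R0 t in auto)
  ultimately show ?thesis by (rule DERIV_unique)
qed

text \<open>The integrated equation has a constant c on the right, for e this constant is 1, and p -
  c e therefore solves the homogeneous integrated equation.\<close>

lemma scalar_solution:
  fixes p :: "real \<Rightarrow> real"
  assumes rho: "0 < \<rho>" "\<rho> < 1"
    and cont: "continuous_on {0<..<T} p"
    and int: "\<And>t. 0 < t \<Longrightarrow> t < T \<Longrightarrow> rl_integrable (1 - \<rho>) p t"
    and deriv: "\<And>t. 0 < t \<Longrightarrow> t < T \<Longrightarrow> (rl_int (1 - \<rho>) p has_real_derivative - l * p t) (at t)"
  obtains c where "\<And>t. 0 < t \<Longrightarrow> t < T \<Longrightarrow> p t = c * ml_fun \<rho> \<rho> (\<lambda>n. (- l) ^ n) t"
proof -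
  have r1: "0 < 1 - \<rho>" "1 - \<rho> \<le> 1" using rho by auto
  let ?e = "ml_fun \<rho> \<rho> (\<lambda>n. (- l) ^ n)"
  have pint: "set_integrable lborel {0<..<t} p" if "0 < t" "t < T" for t
    by (rule rl_integrable_imp_set_integrable[OF r1 int[OF that]])
  have const: "\<exists>c. \<forall>t\<in>{0<..<T}. rl_int (1 - \<rho>) p t + l * (LBINT s:{0<..<t}. p s) = c"
  proof (rule has_field_derivative_zero_constant)
    fix t assume t: "t \<in> {0<..<T}"
    then have t': "0 < t" "t < T" by auto
    have "((\<lambda>t. LBINT s:{0<..<t}. p s) has_real_derivative p t) (at t)"
      by (rule LBINT_has_derivative[OF cont pint t'])
    from DERIV_add[OF deriv[OF t'] DERIV_cmult[OF this, of l]]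
    have "((\<lambda>t. rl_int (1 - \<rho>) p t + l * (LBINT s:{0<..<t}. p s)) has_real_derivative - l * p t + l * p t) (at t)" .
    then have "((\<lambda>t. rl_int (1 - \<rho>) p t + l * (LBINT s:{0<..<t}. p s)) has_real_derivative 0) (at t)"
      by simp
    then show "((\<lambda>t. rl_int (1 - \<rho>) p t + l * (LBINT s:{0<..<t}. p s)) has_real_derivative 0) (at t within {0<..<T})"
      by (rule has_field_derivative_at_within)
  qed auto
  then obtain c where c: "\<And>t. 0 < t \<Longrightarrow> t < T \<Longrightarrow> rl_int (1 - \<rho>) p t + l * (LBINT s:{0<..<t}. p s) = c"
    by auto
  show thesis
  proof
    fix t assume t: "0 < t" "t < T"
    have "p t - c * ?e t = 0"
    proof (rule rl_zero_solution[OF rho _ _ _ t, where l = l])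
      show "continuous_on {0<..<T} (\<lambda>t. p t - c * ?e t)"
        by (intro continuous_on_diff continuous_on_mult continuous_on_const cont
            continuous_on_subset[OF continuous_on_ml_fun[OF rho rho(1) neg_power_bound]]) auto
      fix s assume s: "0 < s" "s < T"
      note E1 = rl_int_ml_fun[OF rho zero_less_one rho(1) neg_power_bound s(1), of l]
      note E2 = rl_int_ml_fun[OF rho r1(1) rho(1) neg_power_bound s(1), of l]
      have ie: "set_integrable lborel {0<..<s} ?e" using E1(1) by (simp add: rl_integrable_1)
      have ie': "set_integrable lborel {0<..<s} (\<lambda>x. c * ?e x)" by (rule set_integrable_mult_right[OF ie])
      show "set_integrable lborel {0<..<s} (\<lambda>t. p t - c * ?e t)"
        by (rule set_integral_diff(1)[OF pint[OF s] ie'])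
      have d1: "(LBINT x:{0<..<s}. p x - c * ?e x) = (LBINT x:{0<..<s}. p x) - c * (LBINT x:{0<..<s}. ?e x)"
        using set_integral_diff(2)[OF pint[OF s] ie'] by simp
      have d2: "rl_int (1 - \<rho>) (\<lambda>t. p t - c * ?e t) s = rl_int (1 - \<rho>) p s - c * rl_int (1 - \<rho>) ?e s"
      proof -
        have "rl_int (1 - \<rho>) (\<lambda>t. p t - c * ?e t) s =
          (LBINT x:{0<..<s}. rl_kernel (1 - \<rho>) (s - x) * p x - c * (rl_kernel (1 - \<rho>) (s - x) * ?e x))"
          by (simp add: rl_int_def algebra_simps)
        also have "\<dots> = rl_int (1 - \<rho>) p s - (LBINT x:{0<..<s}. c * (rl_kernel (1 - \<rho>) (s - x) * ?e x))"
          unfolding rl_int_def using int[OF s] E2(1)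
          by (intro set_integral_diff(2) set_integrable_mult_right) (auto simp: rl_integrable_def)
        finally show ?thesis by (simp add: rl_int_def)
      qed
      have d3: "rl_int (1 - \<rho>) ?e s = 1 - l * (LBINT x:{0<..<s}. ?e x)"
        using E1(2) E2(2) ml_fun_resolvent_scaled[OF rho zero_less_one s(1), of l] s
        by (simp add: rl_int_1 rl_kernel_1)
      have d4: "rl_int (1 - \<rho>) p s = c - l * (LBINT x:{0<..<s}. p x)"
        using c[OF s] by simp
      show "rl_int (1 - \<rho>) (\<lambda>t. p t - c * ?e t) s = - l * (LBINT x:{0<..<s}. p x - c * ?e x)"
        unfolding d1 d2 d3 d4 by (simp add: algebra_simps)
    qed
    then show "p t = c * ?e t" by simp
  qed
qed

section \<open>Expansions in the eigenbasis\<close>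

locale hilbert_basis =
  fixes v :: "nat \<Rightarrow> 'a::{real_inner, banach, second_countable_topology}"
  assumes orthonormal: "\<And>i j. inner (v i) (v j) = (if i = j then 1 else 0)"
    and complete_system: "closure (span (range v)) = UNIV"
begin

text \<open>Inverse of the map from a vector to its coefficients. It is meaningful for
  square-summable sequences, hence the summability hypotheses throughout.\<close>

definition synth :: "(nat \<Rightarrow> real) \<Rightarrow> 'a" where
  "synth a = (\<Sum>k. a k *\<^sub>R v k)"

text \<open>The vectors orthogonal to x - y form a closed subspace containing the dense span. Vector
  identities are reduced to single modes this way.\<close>

lemma eq_if_inner_basis_eq:
  assumes "\<And>k. inner x (v k) = inner y (v k)"
  shows "x = y"
proof -
  define z where "z = x - y"
  have "span (range v) \<subseteq> {w. inner z w = 0}"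
    by (rule span_minimal) (use assms in \<open>auto simp: z_def inner_diff_left subspace_def inner_add_right\<close>)
  moreover have "closed {w. inner z w = 0}"
    by (intro closed_Collect_eq continuous_intros)
  ultimately have "closure (span (range v)) \<subseteq> {w. inner z w = 0}"
    by (rule closure_minimal)
  then have "z \<in> {w. inner z w = 0}" unfolding complete_system by blast
  then show ?thesis by (simp add: z_def)
qed

lemma norm_sum_basis:
  assumes "finite I"
  shows "(norm (\<Sum>k\<in>I. a k *\<^sub>R v k))\<^sup>2 = (\<Sum>k\<in>I. (a k)\<^sup>2)"
proof -
  have "(norm (\<Sum>k\<in>I. a k *\<^sub>R v k))\<^sup>2 = (\<Sum>i\<in>I. \<Sum>j\<in>I. a i * (a j * inner (v i) (v j)))"
    by (simp add: power2_norm_eq_inner inner_sum_left inner_sum_right sum_distrib_left inner_commute mult.left_commute)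
  also have "\<dots> = (\<Sum>i\<in>I. (a i)\<^sup>2)"
    using assms by (intro sum.cong) (auto simp: orthonormal power2_eq_square if_distrib sum.delta cong: if_cong)
  finally show ?thesis .
qed

lemma summable_synth:
  assumes "summable (\<lambda>k. (a k)\<^sup>2)"
  shows "summable (\<lambda>k. a k *\<^sub>R v k)"
  unfolding summable_Cauchy
proof (intro allI impI)
  fix e :: real assume e: "e > 0"
  then have "e\<^sup>2 > 0" by simp
  with assms obtain N where N: "\<And>m n. m \<ge> N \<Longrightarrow> norm (\<Sum>k=m..<n. (a k)\<^sup>2) < e\<^sup>2"
    unfolding summable_Cauchy by meson
  show "\<exists>N. \<forall>m\<ge>N. \<forall>n. norm (\<Sum>k=m..<n. a k *\<^sub>R v k) < e"
  proof (intro exI allI impI)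
    fix m n assume "m \<ge> N"
    from N[OF this, of n] have "(norm (\<Sum>k=m..<n. a k *\<^sub>R v k))\<^sup>2 < e\<^sup>2"
      by (simp add: norm_sum_basis sum_nonneg)
    then show "norm (\<Sum>k=m..<n. a k *\<^sub>R v k) < e"
      using e by (rule power2_less_imp_less[OF _ less_imp_le])
  qed
qed

lemma inner_synth_sums:
  assumes "summable (\<lambda>k. (a k)\<^sup>2)"
  shows "(\<lambda>k. a k * inner x (v k)) sums inner x (synth a)"
proof -
  have "(\<lambda>k. inner x (a k *\<^sub>R v k)) sums inner x (synth a)"
    unfolding synth_def
    by (intro bounded_linear.sums[OF bounded_linear_inner_right] summable_sums summable_synth assms)
  then show ?thesis by simp
qed

lemma inner_synth:
  assumes "summable (\<lambda>k. (a k)\<^sup>2)"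
  shows "inner (synth a) (v k) = a k"
proof -
  have "(\<lambda>j. a j * inner (v k) (v j)) sums inner (v k) (synth a)"
    by (rule inner_synth_sums[OF assms])
  moreover have "(\<lambda>j. a j * inner (v k) (v j)) = (\<lambda>j. if j = k then a j else 0)"
    by (auto simp: orthonormal)
  ultimately have "(\<lambda>j. if j = k then a j else 0) sums inner (v k) (synth a)" by (simp only:)
  from sums_unique2[OF this sums_single] show ?thesis by (simp add: inner_commute)
qed

lemma synth_eqI:
  assumes "summable (\<lambda>k. (a k)\<^sup>2)" "\<And>k. inner x (v k) = a k"
  shows "synth a = x"
  by (rule eq_if_inner_basis_eq) (simp add: inner_synth[OF assms(1)] assms(2))

lemma norm_synth_sums:
  assumes "summable (\<lambda>k. (a k)\<^sup>2)"
  shows "(\<lambda>k. (a k)\<^sup>2) sums (norm (synth a))\<^sup>2"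
  unfolding power2_norm_eq_inner
  using inner_synth_sums[OF assms, of "synth a"] by (simp add: inner_synth[OF assms] power2_eq_square)

lemma synth_mono:
  assumes "\<And>k. \<bar>a k\<bar> \<le> \<bar>b k\<bar>" and b: "summable (\<lambda>k. (b k)\<^sup>2)"
  shows "summable (\<lambda>k. (a k)\<^sup>2)" and "norm (synth a) \<le> norm (synth b)"
proof -
  have le: "(a k)\<^sup>2 \<le> (b k)\<^sup>2" for k using assms(1) by (simp add: abs_le_square_iff)
  show a: "summable (\<lambda>k. (a k)\<^sup>2)"
    by (rule summable_comparison_test'[OF b, of 0]) (use le in auto)
  have "(norm (synth a))\<^sup>2 \<le> (norm (synth b))\<^sup>2"
    by (rule sums_le[OF le norm_synth_sums[OF a] norm_synth_sums[OF b]])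
  then show "norm (synth a) \<le> norm (synth b)" by (rule power2_le_imp_le) simp
qed

lemma summable_mult_const_square:
  fixes b :: "nat \<Rightarrow> real"
  shows "summable (\<lambda>k. (b k)\<^sup>2) \<Longrightarrow> summable (\<lambda>k. (C * b k)\<^sup>2)"
  unfolding power_mult_distrib by (rule summable_mult)

lemma summable_bounded_mult:
  fixes c m :: "nat \<Rightarrow> real"
  assumes m: "\<And>k. \<bar>m k\<bar> \<le> C" and c: "summable (\<lambda>k. (c k)\<^sup>2)"
  shows "summable (\<lambda>k. (m k * c k)\<^sup>2)"
proof (rule synth_mono(1)[OF _ summable_mult_const_square[OF c, of C]])
  fix k show "\<bar>m k * c k\<bar> \<le> \<bar>C * c k\<bar>"
    using m[of k] by (auto simp: abs_mult intro!: mult_right_mono)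
qed

lemma synth_scaleR:
  assumes "summable (\<lambda>k. (a k)\<^sup>2)"
  shows "r *\<^sub>R synth a = synth (\<lambda>k. r * a k)"
  by (rule sym, rule synth_eqI[OF summable_mult_const_square[OF assms]]) (simp add: inner_synth[OF assms])

lemma synth_diff:
  assumes "summable (\<lambda>k. (a k)\<^sup>2)" "summable (\<lambda>k. (b k)\<^sup>2)" "summable (\<lambda>k. (a k - b k)\<^sup>2)"
  shows "synth (\<lambda>k. a k - b k) = synth a - synth b"
  by (rule synth_eqI[OF assms(3)]) (simp add: inner_diff_left inner_synth[OF assms(1)] inner_synth[OF assms(2)])

text \<open>With bounded multipliers on a fixed square-summable sequence, the squared distance to
  the value at \<open>s\<close> is a series dominated by (2 B c_k)^2 independently of t. It is thus
  continuous in t, and it vanishes at \<open>s\<close>.\<close>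

lemma continuous_on_synth:
  fixes c :: "nat \<Rightarrow> real" and m :: "nat \<Rightarrow> 'b::topological_space \<Rightarrow> real"
  assumes c: "summable (\<lambda>k. (c k)\<^sup>2)"
    and m: "\<And>k. continuous_on X (m k)" and B: "\<And>k t. t \<in> X \<Longrightarrow> \<bar>m k t\<bar> \<le> B"
  shows "continuous_on X (\<lambda>t. synth (\<lambda>k. m k t * c k))"
  unfolding continuous_on_def
proof
  fix s assume s: "s \<in> X"
  have bd: "\<bar>m k t - m k s\<bar> \<le> 2 * B" if "t \<in> X" for k t
    using B[OF that, of k] B[OF s, of k] by linarith
  have sq: "summable (\<lambda>k. (m k t * c k)\<^sup>2)" if "t \<in> X" for t
    using B[OF that] by (rule summable_bounded_mult[OF _ c])
  have sqd: "summable (\<lambda>k. ((m k t - m k s) * c k)\<^sup>2)" if "t \<in> X" for t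
    using bd[OF that] by (rule summable_bounded_mult[OF _ c])
  define F where "F t = (\<Sum>k. ((m k t - m k s) * c k)\<^sup>2)" for t
  have F: "F t = (norm (synth (\<lambda>k. m k t * c k) - synth (\<lambda>k. m k s * c k)))\<^sup>2" if "t \<in> X" for t
  proof -
    have "summable (\<lambda>k. (m k t * c k - m k s * c k)\<^sup>2)"
      using sqd[OF that] by (simp add: left_diff_distrib)
    from synth_diff[OF sq[OF that] sq[OF s] this]
    have "synth (\<lambda>k. (m k t - m k s) * c k) = synth (\<lambda>k. m k t * c k) - synth (\<lambda>k. m k s * c k)"
      by (simp add: left_diff_distrib)
    then show ?thesis using norm_synth_sums[OF sqd[OF that]] by (simp add: F_def sums_iff)
  qed
  have "uniform_limit X (\<lambda>n t. \<Sum>k<n. ((m k t - m k s) * c k)\<^sup>2) F sequentially"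
    unfolding F_def
  proof (rule Weierstrass_m_test)
    show "summable (\<lambda>k. (2 * B * c k)\<^sup>2)" by (rule summable_mult_const_square[OF c])
    fix k t assume t: "t \<in> X"
    have "\<bar>(m k t - m k s) * c k\<bar> \<le> \<bar>2 * B * c k\<bar>"
      using bd[OF t, of k] by (auto simp: abs_mult intro!: mult_right_mono)
    then show "norm (((m k t - m k s) * c k)\<^sup>2) \<le> (2 * B * c k)\<^sup>2"
      by (simp add: abs_le_square_iff)
  qed
  then have "continuous_on X F"
    by (rule uniform_limit_theorem[rotated]) (auto intro!: always_eventually continuous_intros m)
  then have "(F \<longlongrightarrow> F s) (at s within X)" using s by (simp add: continuous_on_def)
  then have "((\<lambda>t. sqrt (F t)) \<longlongrightarrow> sqrt (F s)) (at s within X)" by (rule tendsto_real_sqrt)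
  then have "((\<lambda>t. sqrt (F t)) \<longlongrightarrow> 0) (at s within X)" by (simp add: F_def)
  then have "((\<lambda>t. norm (synth (\<lambda>k. m k t * c k) - synth (\<lambda>k. m k s * c k))) \<longlongrightarrow> 0) (at s within X)"
    by (rule Lim_transform_eventually) (auto simp: eventually_at_topological F)
  then show "((\<lambda>t. synth (\<lambda>k. m k t * c k)) \<longlongrightarrow> synth (\<lambda>k. m k s * c k)) (at s within X)"
    by (subst Lim_null, rule tendsto_norm_zero_cancel)
qed

end

section \<open>The operator in terms of coefficients\<close>

context eigen_operator
begin

sublocale hilbert_basis v
  by unfold_locales (rule orthonormal complete_system)+

lemma lam_mono: "lam 0 \<le> lam k"
  using eigenvalue_incseq by (simp add: incseq_def)

lemma lam_pos: "lam k > 0"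
  using eigenvalue_pos lam_mono[of k] by linarith

lemma inner_A: "y \<in> D \<Longrightarrow> inner (A y) (v k) = lam k * inner y (v k)"
proof -
  assume y: "y \<in> D"
  have "(v k, A (v k)) \<in> adjoint_graph D A"
    using selfadjoint eigenvector_dom by (auto simp: selfadjoint_operator_def)
  then have "inner (A y) (v k) = inner y (A (v k))" using y by (simp add: adjoint_graph_def)
  then show ?thesis by (simp add: eigenvector)
qed

text \<open>Membership in the abstract domain \<open>D\<close> comes from selfadjointness: the pair
  lies in the adjoint graph, as tested on coefficients, and that graph is the graph of
  \<open>A\<close>.\<close>

lemma synth_in_dom:
  assumes a: "summable (\<lambda>k. (a k)\<^sup>2)" and la: "summable (\<lambda>k. (lam k * a k)\<^sup>2)"
  shows "synth a \<in> D" and "A (synth a) = synth (\<lambda>k. lam k * a k)"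
proof -
  have "inner (A x) (synth a) = inner x (synth (\<lambda>k. lam k * a k))" if x: "x \<in> D" for x
  proof -
    have "(\<lambda>k. a k * inner (A x) (v k)) sums inner (A x) (synth a)" by (rule inner_synth_sums[OF a])
    then have "(\<lambda>k. lam k * a k * inner x (v k)) sums inner (A x) (synth a)"
      by (simp add: inner_A[OF x] mult_ac)
    then show ?thesis using inner_synth_sums[OF la] sums_unique2 by blast
  qed
  then have "(synth a, synth (\<lambda>k. lam k * a k)) \<in> adjoint_graph D A"
    by (simp add: adjoint_graph_def)
  then have "(synth a, synth (\<lambda>k. lam k * a k)) \<in> {(y, A y) |y. y \<in> D}"
    using selfadjoint by (simp only: selfadjoint_operator_def)
  then show "synth a \<in> D" "A (synth a) = synth (\<lambda>k. lam k * a k)" by auto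
qed

end

section \<open>Solutions of the backward problem\<close>

lemma rl_kernel_frac_kernel: "(1 / Gamma (- (\<rho> - 1))) * (1 / (t - s) powr (\<rho> - 1 + 1)) = rl_kernel (1 - \<rho>) (t - s)"
  by (simp add: rl_kernel_def powr_minus divide_simps)

text \<open>A scalar product with a fixed vector passes through the Bochner integral; this links the
  strong fractional integral to its scalar modes.\<close>

lemma rl_int_inner_frac:
  fixes u :: "real \<Rightarrow> 'a::{real_inner, banach, second_countable_topology}"
  assumes int: "frac_integrable (\<rho> - 1) u t"
  shows "rl_integrable (1 - \<rho>) (\<lambda>s. inner (u s) x) t"
    and "rl_int (1 - \<rho>) (\<lambda>s. inner (u s) x) t = inner (frac_integral (\<rho> - 1) u t) x"
proof -
  let ?G = "\<lambda>s. indicator {0<..<t} s *\<^sub>R ((1 / (t - s) powr (\<rho> - 1 + 1)) *\<^sub>R u s)"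
  have G: "integrable lborel ?G" using int by (simp add: frac_integrable_def set_integrable_def)
  have eq: "indicator {0<..<t} s *\<^sub>R (rl_kernel (1 - \<rho>) (t - s) * inner (u s) x)
      = 1 / Gamma (- (\<rho> - 1)) * inner (?G s) x" for s
    by (simp flip: rl_kernel_frac_kernel)
  have iG: "integrable lborel (\<lambda>s. inner (?G s) x)"
    by (rule integrable_inner_left) (rule G)
  show "rl_integrable (1 - \<rho>) (\<lambda>s. inner (u s) x) t"
    unfolding rl_integrable_def set_integrable_def eq by (rule integrable_mult_right[OF iG])
  have "(\<integral>s. inner (?G s) x \<partial>lborel) = inner (\<integral>s. ?G s \<partial>lborel) x"
    by (rule integral_inner_left) (use G in auto)
  then show "rl_int (1 - \<rho>) (\<lambda>s. inner (u s) x) t = inner (frac_integral (\<rho> - 1) u t) x"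
    unfolding rl_int_def set_lebesgue_integral_def eq frac_integral_def
    by (subst integral_mult_right_zero) simp
qed

lemma frac_integral_cong:
  assumes "\<And>s. 0 < s \<Longrightarrow> s < t \<Longrightarrow> u s = w s"
  shows "frac_integral \<sigma> u t = frac_integral \<sigma> w t"
proof -
  have "(LBINT s:{0<..<t}. (1 / (t - s) powr (\<sigma> + 1)) *\<^sub>R u s) =
      (LBINT s:{0<..<t}. (1 / (t - s) powr (\<sigma> + 1)) *\<^sub>R w s)"
    by (rule set_lebesgue_integral_cong) (use assms in auto)
  then show ?thesis by (simp only: frac_integral_def)
qed

lemma ml_fun_neg:
  "ml_fun \<rho> b (\<lambda>n. (- l) ^ n) t = t powr (b - 1) * mlneg \<rho> b (l * t powr \<rho>)"
  by (simp only: ml_fun_def ml_series_scale[of \<rho> b l])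

lemma ml_fun_neg_pos:
  assumes "0 < \<rho>" "\<rho> < 1" "0 \<le> l" "0 < t"
  shows "ml_fun \<rho> \<rho> (\<lambda>n. (- l) ^ n) t > 0"
  using mlneg_pos[of \<rho> "l * t powr \<rho>"] assms by (simp add: ml_fun_neg)

section \<open>Coefficients and uniqueness of solutions\<close>

context eigen_operator
begin

lemma backward_solution_coeff:
  assumes rho: "0 < \<rho>" "\<rho> < 1" and T: "0 < T"
    and w: "backward_solution D A \<rho> T (\<lambda>t. 0) \<Phi> w" and t: "t \<in> {0<..T}"
  defines "e \<equiv> \<lambda>k. ml_fun \<rho> \<rho> (\<lambda>n. (- lam k) ^ n)"
  shows "inner (w t) (v k) = inner \<Phi> (v k) / e k T * e k t"
proof -
  let ?p = "\<lambda>t. inner (w t) (v k)"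
  have wc: "continuous_on {0<..T} w" and wd: "RL_differentiable_on \<rho> w {0<..<T}"
    and wD: "\<And>t. 0 < t \<Longrightarrow> t < T \<Longrightarrow> w t \<in> D"
    and weq: "\<And>t. 0 < t \<Longrightarrow> t < T \<Longrightarrow> RL_deriv \<rho> w t + A (w t) = 0"
    and wT: "w T = \<Phi>"
    using w by (auto simp: backward_solution_def)
  have fi: "frac_integrable (\<rho> - 1) w t" if "0 < t" "t < T" for t
    using wd that by (simp add: RL_differentiable_on_def)
  have pc: "continuous_on {0<..T} ?p"
    by (intro continuous_intros wc)
  have "(rl_int (1 - \<rho>) ?p has_real_derivative - lam k * ?p t) (at t)" if t: "0 < t" "t < T" for t
  proof -
    have "frac_integral (\<rho> - 1) w differentiable (at t)"
      using wd t by (simp add: RL_differentiable_on_def)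
    then have "(frac_integral (\<rho> - 1) w has_vector_derivative RL_deriv \<rho> w t) (at t)"
      unfolding RL_deriv_def by (simp add: vector_derivative_works)
    from bounded_linear.has_vector_derivative[OF bounded_linear_inner_left this]
    have "((\<lambda>s. inner (frac_integral (\<rho> - 1) w s) (v k)) has_real_derivative inner (RL_deriv \<rho> w t) (v k)) (at t)"
      by (simp add: has_real_derivative_iff_has_vector_derivative)
    moreover have "RL_deriv \<rho> w t = - A (w t)"
      using weq[OF t] by (simp add: eq_neg_iff_add_eq_0)
    then have "inner (RL_deriv \<rho> w t) (v k) = - lam k * ?p t"
      using inner_A[OF wD[OF t]] by simp
    ultimately have "((\<lambda>s. inner (frac_integral (\<rho> - 1) w s) (v k)) has_real_derivative - lam k * ?p t) (at t)"
      by simp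
    then show ?thesis
      by (rule has_field_derivative_transform_within_open[where S = "{0<..<T}"])
        (use t rl_int_inner_frac(2)[OF fi] in auto)
  qed
  moreover have "continuous_on {0<..<T} ?p"
    by (rule continuous_on_subset[OF pc]) auto
  ultimately obtain c where c: "\<And>t. 0 < t \<Longrightarrow> t < T \<Longrightarrow> ?p t = c * e k t"
    using scalar_solution[OF rho, of T ?p "lam k"] rl_int_inner_frac(1)[OF fi] unfolding e_def by metis
  have ec: "continuous_on {0<..T} (e k)"
    unfolding e_def by (rule continuous_on_subset[OF continuous_on_ml_fun[OF rho rho(1) neg_power_bound]]) auto
  \<comment> \<open>The equation holds only on the open interval, so the formula reaches T as a left
    limit; there the value Phi fixes c.\<close>
  have cT: "?p T = c * e k T"
  proof (rule tendsto_unique)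
    show "(?p \<longlongrightarrow> ?p T) (at_left T)"
      using T by (intro continuous_on_Icc_at_leftD[of "T/2" T ?p] continuous_on_subset[OF pc]) auto
    have "(e k \<longlongrightarrow> e k T) (at_left T)"
      using T by (intro continuous_on_Icc_at_leftD[of "T/2" T "e k"] continuous_on_subset[OF ec]) auto
    then have "((\<lambda>t. c * e k t) \<longlongrightarrow> c * e k T) (at_left T)" by (rule tendsto_mult_left)
    moreover have "\<forall>\<^sub>F t in at_left T. c * e k t = ?p t"
      using eventually_at_leftI[of 0 T "\<lambda>t. c * e k t = ?p t"] c T by auto
    ultimately show "(?p \<longlongrightarrow> c * e k T) (at_left T)" by (rule Lim_transform_eventually)
  qed simp
  have "e k T > 0"
    unfolding e_def using ml_fun_neg_pos[OF rho _ T] lam_pos[of k] by (simp add: less_imp_le)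
  then have "c = inner \<Phi> (v k) / e k T" using cT wT by simp
  moreover have "?p t = c * e k t" using c[of t] cT t by (cases "t = T") auto
  ultimately show ?thesis by simp
qed

lemma backward_solution_unique:
  assumes rho: "0 < \<rho>" "\<rho> < 1" and T: "0 < T"
    and w: "backward_solution D A \<rho> T (\<lambda>t. 0) \<Phi> w" and u: "backward_solution D A \<rho> T (\<lambda>t. 0) \<Phi> u"
    and t: "t \<in> {0<..T}"
  shows "w t = u t"
  by (rule eq_if_inner_basis_eq)
    (simp add: backward_solution_coeff[OF rho T w t] backward_solution_coeff[OF rho T u t])

text \<open>The singular factor t^(\<rho>-1) stands in front so that the remaining multipliers are
  bounded uniformly in k and t, as \<open>continuous_on_synth\<close> demands.\<close>

definition ml_solution :: "real \<Rightarrow> (nat \<Rightarrow> real) \<Rightarrow> real \<Rightarrow> 'a" where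
  "ml_solution \<rho> c t = t powr (\<rho> - 1) *\<^sub>R synth (\<lambda>k. mlneg \<rho> \<rho> (lam k * t powr \<rho>) * c k)"

text \<open>Closed form of the fractional integral of order \<rho> - 1 of
  \<open>ml_solution\<close>. Unlike the latter it is continuous up to t = 0.\<close>

definition ml_integral :: "real \<Rightarrow> (nat \<Rightarrow> real) \<Rightarrow> real \<Rightarrow> 'a" where
  "ml_integral \<rho> c t = synth (\<lambda>k. mlneg \<rho> 1 (lam k * t powr \<rho>) * c k)"

section \<open>Construction of the solution from given amplitudes\<close>

context
  fixes \<rho> :: real and c :: "nat \<Rightarrow> real"
  assumes rho: "0 < \<rho>" "\<rho> < 1" and c: "summable (\<lambda>k. (c k)\<^sup>2)"
begin

lemma arg_nonneg: "lam k * t powr \<rho> \<ge> 0"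
  using lam_pos[of k] by simp

lemma mlneg_bound: "x \<ge> 0 \<Longrightarrow> \<bar>mlneg \<rho> \<rho> x\<bar> \<le> 1 / Gamma \<rho>"
  using mlneg_le[OF rho, of x] mlneg_pos[OF rho, of x] by simp

lemma mlneg_1_bound: "x \<ge> 0 \<Longrightarrow> \<bar>mlneg \<rho> 1 x\<bar> \<le> 1"
  using mlneg_1_le_1[OF rho, of x] mlneg_1_ge_0[OF rho, of x] by simp

text \<open>From x \<le> 1 + x^2 and the bounds for E and x^2 E. The estimate is uniform in x, which
  places the solution in \<open>D\<close> for every t > 0 although the amplitudes are only square
  summable.\<close>

lemma mult_mlneg_bound: "x \<ge> 0 \<Longrightarrow> \<bar>x * mlneg \<rho> \<rho> x\<bar> \<le> 1 / Gamma \<rho> + 4 * \<rho> * Gamma (1 + \<rho>)"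
proof -
  assume x: "x \<ge> 0"
  have p: "mlneg \<rho> \<rho> x > 0" by (rule mlneg_pos[OF rho x])
  have "x \<le> 1 + x\<^sup>2"
    using zero_le_power2[of "x - 1"] x unfolding power2_diff by simp
  then have "x * mlneg \<rho> \<rho> x \<le> (1 + x\<^sup>2) * mlneg \<rho> \<rho> x"
    using p by (intro mult_right_mono) auto
  also have "\<dots> \<le> 1 / Gamma \<rho> + 4 * \<rho> * Gamma (1 + \<rho>)"
    using mlneg_le[OF rho x] mlneg_decay_upper[OF rho x] by (simp add: distrib_right)
  finally show ?thesis using x p by simp
qed

lemma continuous_on_mlneg_arg:
  assumes "b > 0" "X \<subseteq> {0..}"
  shows "continuous_on X (\<lambda>t. mlneg \<rho> b (lam k * t powr \<rho>))"
proof (rule continuous_on_compose2[OF continuous_on_ml_series[OF rho assms(1) neg_one_power_bound, of UNIV]])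
  have "continuous_on X (\<lambda>t. t powr \<rho>)"
    using assms(2) rho by (intro continuous_on_powr') auto
  then show "continuous_on X (\<lambda>t. lam k * t powr \<rho>)"
    by (rule continuous_on_mult_left)
qed simp

lemma summable_ml_solution: "summable (\<lambda>k. (mlneg \<rho> \<rho> (lam k * t powr \<rho>) * c k)\<^sup>2)"
  by (rule summable_bounded_mult[OF mlneg_bound[OF arg_nonneg] c])

lemma summable_ml_integral: "summable (\<lambda>k. (mlneg \<rho> 1 (lam k * t powr \<rho>) * c k)\<^sup>2)"
  by (rule summable_bounded_mult[OF mlneg_1_bound[OF arg_nonneg] c])

lemma summable_A_ml_solution:
  "summable (\<lambda>k. ((lam k * t powr \<rho>) * mlneg \<rho> \<rho> (lam k * t powr \<rho>) * c k)\<^sup>2)"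
  by (rule summable_bounded_mult[OF mult_mlneg_bound[OF arg_nonneg] c])

lemma continuous_on_ml_solution: "continuous_on {0<..} (ml_solution \<rho> c)"
proof -
  have "continuous_on {0<..} (\<lambda>t. synth (\<lambda>k. mlneg \<rho> \<rho> (lam k * t powr \<rho>) * c k))"
    by (rule continuous_on_synth[OF c continuous_on_mlneg_arg[OF rho(1)] mlneg_bound[OF arg_nonneg]]) auto
  then show ?thesis
    unfolding ml_solution_def by (intro continuous_intros) auto
qed

lemma continuous_on_ml_integral: "continuous_on {0..} (ml_integral \<rho> c)"
  unfolding ml_integral_def
  by (rule continuous_on_synth[OF c continuous_on_mlneg_arg[OF zero_less_one] mlneg_1_bound[OF arg_nonneg]]) auto

lemma ml_integral_0: "ml_integral \<rho> c 0 = synth c"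
  using rho by (simp add: ml_integral_def ml_series_0)

lemma inner_ml_solution: "inner (ml_solution \<rho> c t) (v k) = c k * ml_fun \<rho> \<rho> (\<lambda>n. (- lam k) ^ n) t"
  by (simp add: ml_solution_def inner_synth[OF summable_ml_solution] ml_fun_neg)

lemma A_ml_solution:
  assumes t: "t > 0"
  shows "ml_solution \<rho> c t \<in> D"
    and "A (ml_solution \<rho> c t) =
      t powr (- 1) *\<^sub>R synth (\<lambda>k. (lam k * t powr \<rho>) * mlneg \<rho> \<rho> (lam k * t powr \<rho>) * c k)"
proof -
  let ?a = "\<lambda>k. t powr (\<rho> - 1) * (mlneg \<rho> \<rho> (lam k * t powr \<rho>) * c k)"
  have pw: "t powr (\<rho> - 1) = t powr (- 1) * t powr \<rho>"
    using powr_add[of t "- 1" \<rho>] by (simp only: uminus_add_conv_diff)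
  have u: "ml_solution \<rho> c t = synth ?a"
    unfolding ml_solution_def by (rule synth_scaleR[OF summable_ml_solution])
  have a: "summable (\<lambda>k. (?a k)\<^sup>2)" by (rule summable_mult_const_square[OF summable_ml_solution])
  have eq: "lam k * ?a k = t powr (- 1) * ((lam k * t powr \<rho>) * mlneg \<rho> \<rho> (lam k * t powr \<rho>) * c k)" for k
    unfolding pw by (simp add: mult_ac)
  have la: "summable (\<lambda>k. (lam k * ?a k)\<^sup>2)"
    unfolding eq by (rule summable_mult_const_square[OF summable_A_ml_solution])
  show "ml_solution \<rho> c t \<in> D" unfolding u by (rule synth_in_dom(1)[OF a la])
  have "A (ml_solution \<rho> c t) = synth (\<lambda>k. lam k * ?a k)"
    unfolding u by (rule synth_in_dom(2)[OF a la])
  then show "A (ml_solution \<rho> c t) =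
      t powr (- 1) *\<^sub>R synth (\<lambda>k. (lam k * t powr \<rho>) * mlneg \<rho> \<rho> (lam k * t powr \<rho>) * c k)"
    unfolding eq by (simp only: synth_scaleR[OF summable_A_ml_solution])
qed

lemma continuous_on_A_ml_solution: "continuous_on {0<..} (\<lambda>t. A (ml_solution \<rho> c t))"
proof -
  have "continuous_on {0<..} (\<lambda>t. synth (\<lambda>k. (lam k * t powr \<rho>) * mlneg \<rho> \<rho> (lam k * t powr \<rho>) * c k))"
  proof (rule continuous_on_synth[OF c _ mult_mlneg_bound[OF arg_nonneg]])
    fix k
    show "continuous_on {0<..} (\<lambda>t. lam k * t powr \<rho> * mlneg \<rho> \<rho> (lam k * t powr \<rho>))"
      by (intro continuous_on_mult continuous_on_mlneg_arg rho continuous_intros) auto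
  qed
  then have "continuous_on {0<..} (\<lambda>t. t powr (- 1) *\<^sub>R
      synth (\<lambda>k. (lam k * t powr \<rho>) * mlneg \<rho> \<rho> (lam k * t powr \<rho>) * c k))"
    by (intro continuous_intros) auto
  then show ?thesis
    by (rule continuous_on_eq) (simp add: A_ml_solution(2))
qed

text \<open>The solution is bounded by a multiple of s^(\<rho>-1), so the integrand is dominated by
  a product of two kernels, whose integral is of Beta type.\<close>

lemma frac_integrable_ml_solution:
  assumes t: "t > 0"
  shows "frac_integrable (\<rho> - 1) (ml_solution \<rho> c) t"
proof -
  define B where "B = norm (synth (\<lambda>k. 1 / Gamma \<rho> * c k))"
  have B: "norm (synth (\<lambda>k. mlneg \<rho> \<rho> (lam k * s powr \<rho>) * c k)) \<le> B" for s
    unfolding B_def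
  proof (rule synth_mono(2)[OF _ summable_mult_const_square[OF c]])
    fix k show "\<bar>mlneg \<rho> \<rho> (lam k * s powr \<rho>) * c k\<bar> \<le> \<bar>1 / Gamma \<rho> * c k\<bar>"
      using mlneg_bound[OF arg_nonneg[of k s]] Gamma_real_pos[OF rho(1)]
      by (simp only: abs_mult) (intro mult_right_mono, auto)
  qed
  have r1: "1 - \<rho> > 0" using rho by simp
  let ?K = "\<lambda>s. indicator {0<..<t} s *\<^sub>R (rl_kernel (1 - \<rho>) (t - s) * rl_kernel \<rho> s)"
  let ?C = "Gamma (1 - \<rho>) * Gamma \<rho> * B"
  have K: "integrable lborel ?K"
    using rl_kernel_conv(1)[OF r1 rho(1) t] by (simp add: rl_integrable_def set_integrable_def)
  have G: "Gamma (1 - \<rho>) > 0" "Gamma \<rho> > 0" using r1 rho by (auto intro!: Gamma_real_pos)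
  show ?thesis
    unfolding frac_integrable_def set_integrable_def
  proof (rule Bochner_Integration.integrable_bound)
    show "integrable lborel (\<lambda>s. ?C * ?K s)" by (rule integrable_mult_right[OF K])
    have "continuous_on {0<..<t} (\<lambda>s. (1 / (t - s) powr (\<rho> - 1 + 1)) *\<^sub>R ml_solution \<rho> c s)"
      by (intro continuous_intros continuous_on_subset[OF continuous_on_ml_solution]) auto
    from borel_measurable_continuous_on_indicator[OF _ this]
    show "(\<lambda>s. indicator {0<..<t} s *\<^sub>R ((1 / (t - s) powr (\<rho> - 1 + 1)) *\<^sub>R ml_solution \<rho> c s)) \<in> borel_measurable lborel"
      by simp
    show "AE s in lborel. norm (indicator {0<..<t} s *\<^sub>R ((1 / (t - s) powr (\<rho> - 1 + 1)) *\<^sub>R ml_solution \<rho> c s))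
        \<le> norm (?C * ?K s)"
    proof (rule AE_I2)
      fix s
      show "norm (indicator {0<..<t} s *\<^sub>R ((1 / (t - s) powr (\<rho> - 1 + 1)) *\<^sub>R ml_solution \<rho> c s))
        \<le> norm (?C * ?K s)"
      proof (cases "s \<in> {0<..<t}")
        case True
        have "norm (ml_solution \<rho> c s) \<le> s powr (\<rho> - 1) * B"
          unfolding ml_solution_def norm_scaleR using B[of s] by (intro mult_mono) auto
        then have "1 / (t - s) powr \<rho> * norm (ml_solution \<rho> c s) \<le> 1 / (t - s) powr \<rho> * (s powr (\<rho> - 1) * B)"
          by (intro mult_left_mono) auto
        also have "\<dots> = ?C * (rl_kernel (1 - \<rho>) (t - s) * rl_kernel \<rho> s)"
          using G by (simp add: rl_kernel_def powr_minus divide_simps)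
        finally have "1 / (t - s) powr \<rho> * norm (ml_solution \<rho> c s) \<le> ?C * (rl_kernel (1 - \<rho>) (t - s) * rl_kernel \<rho> s)" .
        then have "1 / (t - s) powr \<rho> * norm (ml_solution \<rho> c s) \<le> \<bar>?C * (rl_kernel (1 - \<rho>) (t - s) * rl_kernel \<rho> s)\<bar>"
          by linarith
        then show ?thesis using True by simp
      qed simp
    qed
  qed
qed

lemma frac_integral_ml_solution:
  assumes t: "t > 0"
  shows "frac_integral (\<rho> - 1) (ml_solution \<rho> c) t = ml_integral \<rho> c t"
proof (rule eq_if_inner_basis_eq)
  fix k
  have r1: "1 - \<rho> > 0" using rho by simp
  let ?e = "ml_fun \<rho> \<rho> (\<lambda>n. (- lam k) ^ n)"
  have "inner (frac_integral (\<rho> - 1) (ml_solution \<rho> c) t) (v k) = rl_int (1 - \<rho>) (\<lambda>s. c k * ?e s) t"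
    using rl_int_inner_frac(2)[OF frac_integrable_ml_solution[OF t], of "v k"]
    by (simp add: inner_ml_solution)
  also have "\<dots> = (LBINT s:{0<..<t}. c k * (rl_kernel (1 - \<rho>) (t - s) * ?e s))"
    by (simp add: rl_int_def mult.left_commute)
  also have "\<dots> = c k * rl_int (1 - \<rho>) ?e t"
    unfolding rl_int_def by (rule set_integral_mult_right)
  also have "rl_int (1 - \<rho>) ?e t = ml_fun \<rho> 1 (\<lambda>n. (- lam k) ^ n) t"
    using rl_int_ml_fun(2)[OF rho r1 rho(1) neg_power_bound t, of "lam k"] by simp
  also have "\<dots> = mlneg \<rho> 1 (lam k * t powr \<rho>)"
    using t by (simp add: ml_fun_neg)
  finally show "inner (frac_integral (\<rho> - 1) (ml_solution \<rho> c) t) (v k) = inner (ml_integral \<rho> c t) (v k)"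
    by (simp add: ml_integral_def inner_synth[OF summable_ml_integral])
qed

lemma ml_integral_mode_derivative:
  assumes t: "t > 0"
  shows "((\<lambda>t. inner (ml_integral \<rho> c t) (v k)) has_real_derivative - inner (A (ml_solution \<rho> c t)) (v k)) (at t)"
proof -
  let ?x = "\<lambda>t. lam k * t powr \<rho>"
  have "(?x has_real_derivative lam k * (\<rho> * t powr (\<rho> - 1))) (at t)"
    using t by (intro DERIV_cmult has_real_derivative_powr) auto
  from DERIV_chain2[OF mlneg_1_deriv[OF rho] this]
  have "((\<lambda>t. mlneg \<rho> 1 (?x t)) has_real_derivative
      - mlneg \<rho> \<rho> (?x t) / \<rho> * (lam k * (\<rho> * t powr (\<rho> - 1)))) (at t)" .
  then have "((\<lambda>t. mlneg \<rho> 1 (?x t) * c k) has_real_derivative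
      - mlneg \<rho> \<rho> (?x t) / \<rho> * (lam k * (\<rho> * t powr (\<rho> - 1))) * c k) (at t)"
    by (rule DERIV_cmult_right)
  moreover have "- mlneg \<rho> \<rho> (?x t) / \<rho> * (lam k * (\<rho> * t powr (\<rho> - 1))) * c k
      = - inner (A (ml_solution \<rho> c t)) (v k)"
    using rho by (simp add: inner_A[OF A_ml_solution(1)[OF t]] inner_ml_solution ml_fun_neg)
  ultimately show ?thesis
    unfolding ml_integral_def inner_synth[OF summable_ml_integral] by simp
qed

text \<open>Differentiating each mode does not give a strong derivative. The modes only identify
  \<open>ml_integral\<close> as a primitive of the continuous function - A u; the vector-valued
  fundamental theorem does the rest.\<close>

lemma ml_integral_derivative:
  assumes t: "t > 0"
  shows "(ml_integral \<rho> c has_vector_derivative - A (ml_solution \<rho> c t)) (at t)"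
proof -
  define a where "a = t / 2"
  define b where "b = 2 * t"
  have ab: "0 < a" "a < t" "t < b" using t by (auto simp: a_def b_def)
  let ?g = "\<lambda>t. - A (ml_solution \<rho> c t)"
  have gc: "continuous_on {a..b} ?g"
    using ab by (intro continuous_on_minus continuous_on_subset[OF continuous_on_A_ml_solution]) auto
  have rep: "ml_integral \<rho> c s = ml_integral \<rho> c a + integral {a..s} ?g" if s: "s \<in> {a..b}" for s
  proof (rule eq_if_inner_basis_eq)
    fix k
    have gi: "?g integrable_on {a..s}"
      using s by (intro integrable_continuous_interval continuous_on_subset[OF gc]) auto
    have "((\<lambda>r. inner (?g r) (v k)) has_integral inner (integral {a..s} ?g) (v k)) {a..s}"
      using has_integral_linear[OF integrable_integral[OF gi] bounded_linear_inner_left[of "v k"]]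
      by (simp add: o_def)
    moreover have "((\<lambda>r. inner (?g r) (v k)) has_integral
        (inner (ml_integral \<rho> c s) (v k) - inner (ml_integral \<rho> c a) (v k))) {a..s}"
    proof (rule fundamental_theorem_of_calculus)
      fix r assume r: "r \<in> {a..s}"
      then have "((\<lambda>t. inner (ml_integral \<rho> c t) (v k)) has_real_derivative inner (?g r) (v k)) (at r)"
        using ml_integral_mode_derivative[of r k] ab by simp
      then show "((\<lambda>t. inner (ml_integral \<rho> c t) (v k)) has_vector_derivative inner (?g r) (v k)) (at r within {a..s})"
        by (simp add: has_real_derivative_iff_has_vector_derivative has_vector_derivative_at_within)
    qed (use s in auto)
    ultimately have "inner (integral {a..s} ?g) (v k) = inner (ml_integral \<rho> c s) (v k) - inner (ml_integral \<rho> c a) (v k)"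
      by (rule has_integral_unique)
    then show "inner (ml_integral \<rho> c s) (v k) = inner (ml_integral \<rho> c a + integral {a..s} ?g) (v k)"
      unfolding inner_add_left by linarith
  qed
  have "((\<lambda>u. integral {a..u} ?g) has_vector_derivative ?g t) (at t within {a..b})"
    using ab by (intro integral_has_vector_derivative gc) auto
  then have "((\<lambda>u. integral {a..u} ?g) has_vector_derivative ?g t) (at t)"
    using ab by (simp add: at_within_Icc_at)
  from has_vector_derivative_add[OF has_vector_derivative_const[of "ml_integral \<rho> c a"] this]
  have "((\<lambda>u. ml_integral \<rho> c a + integral {a..u} ?g) has_vector_derivative ?g t) (at t)"
    by (simp only: add_0_left)
  then show ?thesis
  proof (rule has_vector_derivative_transform_within_open[where S = "{a<..<b}"])
    fix s assume "s \<in> {a<..<b}"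
    then show "ml_integral \<rho> c a + integral {a..s} ?g = ml_integral \<rho> c s"
      by (intro rep[symmetric]) auto
  qed (use ab in auto)
qed

lemma frac_integral_ml_solution_derivative:
  assumes t: "t > 0"
  shows "(frac_integral (\<rho> - 1) (ml_solution \<rho> c) has_vector_derivative - A (ml_solution \<rho> c t)) (at t)"
  by (rule has_vector_derivative_transform_within_open[OF ml_integral_derivative[OF t], where S = "{0<..}"])
    (use t frac_integral_ml_solution in auto)

lemma backward_solution_ml_solution:
  assumes T: "0 < T"
  shows "backward_solution D A \<rho> T (\<lambda>t. 0) (ml_solution \<rho> c T) (ml_solution \<rho> c)"
proof -
  have d: "RL_deriv \<rho> (ml_solution \<rho> c) t = - A (ml_solution \<rho> c t)" if "t > 0" for t
    unfolding RL_deriv_def by (rule vector_derivative_at[OF frac_integral_ml_solution_derivative[OF that]])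
  have "continuous_on {0<..<T} (RL_deriv \<rho> (ml_solution \<rho> c))"
  proof (rule continuous_on_eq)
    show "continuous_on {0<..<T} (\<lambda>t. - A (ml_solution \<rho> c t))"
      by (intro continuous_on_minus continuous_on_subset[OF continuous_on_A_ml_solution]) auto
  qed (simp add: d)
  moreover have "RL_differentiable_on \<rho> (ml_solution \<rho> c) {0<..<T}"
    using frac_integrable_ml_solution differentiableI_vector[OF frac_integral_ml_solution_derivative]
    by (simp add: RL_differentiable_on_def)
  moreover have "continuous_on {0<..T} (ml_solution \<rho> c)"
    by (rule continuous_on_subset[OF continuous_on_ml_solution]) auto
  moreover have "continuous_on {0<..<T} (\<lambda>t. A (ml_solution \<rho> c t))"
    by (rule continuous_on_subset[OF continuous_on_A_ml_solution]) auto
  ultimately show ?thesis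
    using A_ml_solution(1) by (simp add: backward_solution_def d)
qed

lemma frac_integral_ml_solution_tendsto:
  "(frac_integral (\<rho> - 1) (ml_solution \<rho> c) \<longlongrightarrow> synth c) (at_right 0)"
proof -
  have "(ml_integral \<rho> c \<longlongrightarrow> ml_integral \<rho> c 0) (at 0 within {0..})"
    using continuous_on_ml_integral by (simp add: continuous_on_def)
  then have "(ml_integral \<rho> c \<longlongrightarrow> synth c) (at_right 0)"
    unfolding ml_integral_0 by (rule tendsto_within_subset) auto
  then show ?thesis
    by (rule Lim_transform_eventually)
      (use eventually_at_right_less[of 0] in eventually_elim, simp add: frac_integral_ml_solution)
qed

end

end

text \<open>With x = lam k T^\<rho> the quantity equals T^(-1-\<rho>) x^2 E_{\<rho>,\<rho>}(-x), and
  x stays above lam 0 T^\<rho> > 0. The bounds are therefore uniform in k.\<close>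

lemma (in eigen_operator) mode_bounds:
  assumes rho: "0 < \<rho>" "\<rho> < 1" and T: "0 < T"
  obtains C1 C2 where "C1 > 0" "C2 > 0"
    and "\<And>k. C1 \<le> lam k powr 2 * ml_fun \<rho> \<rho> (\<lambda>n. (- lam k) ^ n) T"
    and "\<And>k. lam k powr 2 * ml_fun \<rho> \<rho> (\<lambda>n. (- lam k) ^ n) T \<le> C2"
proof -
  define \<kappa> where "\<kappa> = T powr (- 1 - \<rho>)"
  have \<kappa>: "\<kappa> > 0" using T by (simp add: \<kappa>_def)
  have "lam 0 * T powr \<rho> > 0" using T lam_pos by simp
  then obtain q where q: "q > 0" "\<And>x. x \<ge> lam 0 * T powr \<rho> \<Longrightarrow> q \<le> x\<^sup>2 * mlneg \<rho> \<rho> x"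
    using mlneg_decay_lower[OF rho] by blast
  define Q where "Q = 4 * \<rho> * Gamma (1 + \<rho>)"
  have Q: "Q > 0" using rho by (simp add: Q_def Gamma_real_pos)
  have eq: "lam k powr 2 * ml_fun \<rho> \<rho> (\<lambda>n. (- lam k) ^ n) T
      = \<kappa> * ((lam k * T powr \<rho>)\<^sup>2 * mlneg \<rho> \<rho> (lam k * T powr \<rho>))" for k
  proof -
    have "T powr (\<rho> - 1) = \<kappa> * (T powr \<rho>)\<^sup>2"
    proof -
      have "\<kappa> * (T powr \<rho>)\<^sup>2 = T powr (- 1 - \<rho> + (\<rho> + \<rho>))"
        unfolding \<kappa>_def powr_add power2_eq_square ..
      then show ?thesis by simp
    qed
    moreover have "lam k powr 2 = (lam k)\<^sup>2" using lam_pos[of k] by (simp add: powr_numeral)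
    ultimately show ?thesis by (simp add: ml_fun_neg power_mult_distrib)
  qed
  show thesis
  proof
    show "\<kappa> * q > 0" "\<kappa> * Q > 0" using \<kappa> q Q by auto
    fix k
    have "lam 0 * T powr \<rho> \<le> lam k * T powr \<rho>" using lam_mono[of k] by (intro mult_right_mono) auto
    then show "\<kappa> * q \<le> lam k powr 2 * ml_fun \<rho> \<rho> (\<lambda>n. (- lam k) ^ n) T"
      unfolding eq using \<kappa> q(2) by (intro mult_left_mono) auto
    show "lam k powr 2 * ml_fun \<rho> \<rho> (\<lambda>n. (- lam k) ^ n) T \<le> \<kappa> * Q"
      unfolding eq Q_def using \<kappa> lam_pos[of k]
      by (intro mult_left_mono mlneg_decay_upper[OF rho]) auto
  qed
qed

theorem theorem1p2:
  fixes D :: "'a::{real_inner, banach, second_countable_topology} set"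
    and A :: "'a \<Rightarrow> 'a" and v :: "nat \<Rightarrow> 'a" and lam :: "nat \<Rightarrow> real"
    and \<rho> T :: real
  assumes "eigen_operator D A v lam"
    and "0 < \<rho>" "\<rho> < 1" "0 < T"
  shows "(\<forall>\<Phi> \<in> pow_dom v lam 2.
            \<exists>u. backward_solution D A \<rho> T (\<lambda>t. 0) \<Phi> u \<and>
              (\<forall>w. backward_solution D A \<rho> T (\<lambda>t. 0) \<Phi> w \<longrightarrow> (\<forall>t\<in>{0<..T}. w t = u t))) \<and>
         (\<exists>C1 > 0. \<exists>C2 > 0. \<forall>\<Phi> \<in> pow_dom v lam 2. \<forall>u.
            backward_solution D A \<rho> T (\<lambda>t. 0) \<Phi> u \<longrightarrow>
            (\<exists>L. ((\<lambda>t. norm (frac_integral (\<rho> - 1) u t)) \<longlongrightarrow> L) (at_right 0) \<and>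
                 C1 * L \<le> pow_norm v lam 2 (u T) \<and>
                 pow_norm v lam 2 (u T) \<le> C2 * L))"
proof -
  interpret eigen_operator D A v lam by fact
  note rho = \<open>0 < \<rho>\<close> \<open>\<rho> < 1\<close> and T = \<open>0 < T\<close>
  define e where "e k = ml_fun \<rho> \<rho> (\<lambda>n. (- lam k) ^ n) T" for k
  obtain C1 C2 where C: "C1 > 0" "C2 > 0" "\<And>k. C1 \<le> lam k powr 2 * e k" "\<And>k. lam k powr 2 * e k \<le> C2"
    using mode_bounds[OF rho T] unfolding e_def by blast
  have e_pos: "e k > 0" for k
    unfolding e_def using ml_fun_neg_pos[OF rho _ T] lam_pos[of k] by (simp add: less_imp_le)
  \<comment> \<open>The amplitude that the final value forces on mode k, so
    \<open>synth (coef \<Phi>)\<close> is the limit of the fractional integral at 0.\<close>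
  define coef where "coef \<Phi> k = inner \<Phi> (v k) / e k" for \<Phi> k
  define b where "b \<Phi> k = lam k powr 2 * inner \<Phi> (v k)" for \<Phi> k
  have b_eq: "b \<Phi> k = lam k powr 2 * e k * coef \<Phi> k" for \<Phi> k
    using e_pos[of k] by (simp add: b_def coef_def)
  \<comment> \<open>\<open>b \<Phi>\<close> are the coefficients of A^2 Phi. This pair of bounds
    gives the solvability for Phi in D(A^2) as well as both norm inequalities, with the constants
    \<open>C1\<close> and \<open>C2\<close> of the theorem.\<close>
  have low: "\<bar>C1 * coef \<Phi> k\<bar> \<le> \<bar>b \<Phi> k\<bar>" and up: "\<bar>b \<Phi> k\<bar> \<le> \<bar>C2 * coef \<Phi> k\<bar>" for \<Phi> k
    unfolding b_eq abs_mult[of C1] abs_mult[of C2] abs_mult[of "lam k powr 2 * e k"]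
    using C(1) C(3)[of k] C(4)[of k] by (intro mult_right_mono; simp)+
  have b_sum: "summable (\<lambda>k. (b \<Phi> k)\<^sup>2)" if "\<Phi> \<in> pow_dom v lam 2" for \<Phi>
  proof -
    have "lam k powr (2 * 2) * \<bar>inner \<Phi> (v k)\<bar>\<^sup>2 = (b \<Phi> k)\<^sup>2" for k
    proof -
      have "lam k powr (2 * 2) = (lam k powr 2)\<^sup>2"
        using powr_add[of "lam k" 2 2] by (simp add: power2_eq_square)
      then show ?thesis by (simp add: b_def power_mult_distrib)
    qed
    then show ?thesis using that by (simp add: pow_dom_def)
  qed
  have coef_sum: "summable (\<lambda>k. (coef \<Phi> k)\<^sup>2)" if \<Phi>: "\<Phi> \<in> pow_dom v lam 2" for \<Phi>
  proof -
    have "summable (\<lambda>k. (C1 * coef \<Phi> k)\<^sup>2)"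
      by (rule synth_mono(1)[OF low b_sum[OF \<Phi>]])
    from summable_mult_const_square[OF this, of "1 / C1"] show ?thesis using C(1) by simp
  qed
  have sol: "backward_solution D A \<rho> T (\<lambda>t. 0) \<Phi> (ml_solution \<rho> (coef \<Phi>))" if \<Phi>: "\<Phi> \<in> pow_dom v lam 2" for \<Phi>
  proof -
    have "ml_solution \<rho> (coef \<Phi>) T = \<Phi>"
    proof (rule eq_if_inner_basis_eq)
      fix k show "inner (ml_solution \<rho> (coef \<Phi>) T) (v k) = inner \<Phi> (v k)"
        using e_pos[of k] by (simp add: inner_ml_solution[OF rho coef_sum[OF \<Phi>]] coef_def flip: e_def)
    qed
    then show ?thesis using backward_solution_ml_solution[OF rho coef_sum[OF \<Phi>] T] by simp
  qed
  have est: "\<exists>L. ((\<lambda>t. norm (frac_integral (\<rho> - 1) u t)) \<longlongrightarrow> L) (at_right 0) \<and>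
      C1 * L \<le> pow_norm v lam 2 (u T) \<and> pow_norm v lam 2 (u T) \<le> C2 * L"
    if \<Phi>: "\<Phi> \<in> pow_dom v lam 2" and u: "backward_solution D A \<rho> T (\<lambda>t. 0) \<Phi> u" for \<Phi> u
  proof (intro exI conjI)
    have uT: "u T = \<Phi>" using u by (simp add: backward_solution_def)
    have norm_uT: "pow_norm v lam 2 (u T) = norm (synth (b \<Phi>))"
      by (simp add: pow_norm_def op_pow_def synth_def b_def uT)
    have scale: "norm (synth (\<lambda>k. r * coef \<Phi> k)) = r * norm (synth (coef \<Phi>))" if "r > 0" for r
      using that by (simp flip: synth_scaleR[OF coef_sum[OF \<Phi>]])
    \<comment> \<open>An arbitrary solution agrees with the constructed one on (0, T] only, which
      suffices because the fractional integral at t < T sees only (0, t).\<close>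
    have "\<forall>\<^sub>F t in at_right 0. frac_integral (\<rho> - 1) (ml_solution \<rho> (coef \<Phi>)) t = frac_integral (\<rho> - 1) u t"
    proof (rule eventually_at_rightI[OF _ T])
      fix t assume t: "t \<in> {0<..<T}"
      show "frac_integral (\<rho> - 1) (ml_solution \<rho> (coef \<Phi>)) t = frac_integral (\<rho> - 1) u t"
        by (rule frac_integral_cong) (use t backward_solution_unique[OF rho T sol[OF \<Phi>] u] in auto)
    qed
    from Lim_transform_eventually[OF frac_integral_ml_solution_tendsto[OF rho coef_sum[OF \<Phi>]] this]
    show "((\<lambda>t. norm (frac_integral (\<rho> - 1) u t)) \<longlongrightarrow> norm (synth (coef \<Phi>))) (at_right 0)"
      by (rule tendsto_norm)
    show "C1 * norm (synth (coef \<Phi>)) \<le> pow_norm v lam 2 (u T)"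
      unfolding norm_uT scale[OF C(1), symmetric] by (rule synth_mono(2)[OF low b_sum[OF \<Phi>]])
    show "pow_norm v lam 2 (u T) \<le> C2 * norm (synth (coef \<Phi>))"
      unfolding norm_uT scale[OF C(2), symmetric]
      by (rule synth_mono(2)[OF up summable_mult_const_square[OF coef_sum[OF \<Phi>]]])
  qed
  show ?thesis
  proof (intro conjI)
    show "\<forall>\<Phi> \<in> pow_dom v lam 2. \<exists>u. backward_solution D A \<rho> T (\<lambda>t. 0) \<Phi> u \<and>
        (\<forall>w. backward_solution D A \<rho> T (\<lambda>t. 0) \<Phi> w \<longrightarrow> (\<forall>t\<in>{0<..T}. w t = u t))"
      using sol backward_solution_unique[OF rho T] by blast
  qed (use C(1,2) est in blast)
qed

end
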